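(* Let $T:\Omega\times S^2\to\mathbb{R}$ be a zero-mean Gaussian isotropic spherical random field whose angular power spectrum $\{C_\ell\}_{\ell\ge 0}$ satisfies $0<C_\ell<\infty$ for all $\ell\ge 0$ and $C_\ell\le K\ell^{-\alpha}$ for all $\ell\ge 1$, for some constants $K>0$, $\alpha>2$. Let $\Psi$ be the spherical harmonic dictionary, i.e. $\Psi\alpha=\sum_{\ell m}\alpha_{\ell m}Y_{\ell m}$ for complex coefficient arrays $\alpha=\{\alpha_{\ell m}\}$. Then for any given $\delta,\varepsilon>0$ there exists a positive $\lambda=\lambda(\delta,\varepsilon)$ such that the solution $$\alpha^{reg}:=\arg\min_{\alpha}\left\{\lambda(\delta,\varepsilon)\|\alpha\|_{\ell^1}+\tfrac12\|T-\Psi\alpha\|^2_{L^2(S^2)}\right\}$$ satisfies $$\Pr\left\{\|T-\Psi\alpha^{reg}\|_{L^2(S^2)}\le\varepsilon\right\}\ge 1-\delta .$$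
   Context: $\{Y_{\ell m}\}_{\ell\ge0,\,-\ell\le m\le\ell}$ denotes the standard complex orthonormal basis of spherical harmonics of $L^2(S^2)$, with $Y_{\ell m}=(-1)^m\overline{Y}_{\ell,-m}$. A random field $T$ on $S^2$ is isotropic if $T(\cdot)$ and $T(g\,\cdot)$ have the same law for all $g\in SO(3)$. A zero-mean Gaussian isotropic field has the expansion $T=\sum_{\ell=0}^\infty\sum_{m=-\ell}^{\ell}a_{\ell m}Y_{\ell m}$, where $a_{\ell,-m}=(-1)^m\overline{a}_{\ell m}$, the coefficients $\{a_{\ell m}\}_{\ell\ge0,\,0\le m\le \ell}$ are independent, $a_{\ell0}$ is real centred Gaussian with variance $C_\ell$, and for $m\ne0$ the real and imaginary parts of $a_{\ell m}$ are independent centred Gaussians with variance $C_\ell/2$. The sequence $\{C_\ell\}$ is the angular power spectrum. $\|\alpha\|_{\ell^1}=\sum_{\ell m}|\alpha_{\ell m}|$ with $|\cdot|$ the complex modulus. The minimization is performed for each realization of $T$. *)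

theory Defs
  imports "HOL-Probability.Probability" "HOL-Computational_Algebra.Polynomial"
begin

definition S2 :: "(real ^ 3) set" where
  "S2 = sphere 0 1"

definition sphere_point :: "real \<times> real \<Rightarrow> real ^ 3" where
  "sphere_point = (\<lambda>(\<theta>, \<phi>). vector [sin \<theta> * cos \<phi>, sin \<theta> * sin \<phi>, cos \<theta>])"

(* The surface measure sin \<theta> d\<theta> d\<phi>, of total mass 4 pi. *)
definition sphere_measure :: "(real ^ 3) measure" where
  "sphere_measure =
     distr (density lborel
              (\<lambda>(\<theta>, \<phi>). ennreal (sin \<theta>) * indicator ({0..pi} \<times> {0..2 * pi}) (\<theta>, \<phi>)))
       (restrict_space borel S2) sphere_point"

(* Rodrigues' formula *)
definition legendre_poly :: "nat \<Rightarrow> real poly" where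
  "legendre_poly l = smult (1 / (2 ^ l * fact l)) ((pderiv ^^ l) ([:-1, 0, 1:] ^ l))"

(* With the Condon-Shortley phase (-1)^m; sqrt (1 - t^2) ^ m is (1 - t^2)^(m/2). *)
definition assoc_legendre :: "nat \<Rightarrow> nat \<Rightarrow> real \<Rightarrow> real" where
  "assoc_legendre l m t =
     (-1) ^ m * sqrt (1 - t\<^sup>2) ^ m * poly ((pderiv ^^ m) (legendre_poly l)) t"

(* At sphere_point (\<theta>, \<phi>) this is N * P_lm (cos \<theta>) * exp (i m \<phi>): the third coordinate is
   cos \<theta>, and the argument of x1 + i x2 is \<phi> modulo 2 pi. At the poles, where \<phi> is
   undetermined, either m = 0 or P_lm vanishes. *)
definition sph_harm_nonneg :: "nat \<Rightarrow> nat \<Rightarrow> real ^ 3 \<Rightarrow> complex" where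
  "sph_harm_nonneg l m x =
     of_real (sqrt ((2 * real l + 1) / (4 * pi) * (fact (l - m) / fact (l + m)))
                * assoc_legendre l m (x $ 3))
       * cis (real m * Arg (Complex (x $ 1) (x $ 2)))"

(* Only meaningful for -l \<le> m \<le> l. *)
definition sph_harm :: "nat \<Rightarrow> int \<Rightarrow> real ^ 3 \<Rightarrow> complex" where
  "sph_harm l m x =
     (if 0 \<le> m then sph_harm_nonneg l (nat m) x
      else (-1) ^ nat (- m) * cnj (sph_harm_nonneg l (nat (- m)) x))"

(* The L^2(S^2) norm, with value \<infinity> outside L^2. *)
definition L2norm :: "(real ^ 3 \<Rightarrow> complex) \<Rightarrow> ennreal" where
  "L2norm f =
     (let I = (\<integral>\<^sup>+x. ennreal ((cmod (f x))\<^sup>2) \<partial>sphere_measure)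
      in if I = \<infinity> then \<infinity> else ennreal (sqrt (enn2real I)))"

definition coef_index :: "(nat \<times> int) set" where
  "coef_index = {(l, m). \<bar>m\<bar> \<le> int l}"

(* Arrays are total functions; they are 0 off the index set so that equality is equality of
   arrays. *)
definition coef_arrays :: "(nat \<times> int \<Rightarrow> complex) set" where
  "coef_arrays = {a. \<forall>i. i \<notin> coef_index \<longrightarrow> a i = 0}"

definition l1norm :: "(nat \<times> int \<Rightarrow> complex) \<Rightarrow> ennreal" where
  "l1norm a = (\<Sum>\<^sub>\<infinity>i\<in>coef_index. ennreal (cmod (a i)))"

definition partial_synthesis :: "(nat \<times> int \<Rightarrow> complex) \<Rightarrow> nat \<Rightarrow> real ^ 3 \<Rightarrow> complex" where
  "partial_synthesis a L x = (\<Sum>l\<le>L. \<Sum>m = - int l..int l. a (l, m) * sph_harm l m x)"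

definition is_L2_sum :: "(nat \<times> int \<Rightarrow> complex) \<Rightarrow> (real ^ 3 \<Rightarrow> complex) \<Rightarrow> bool" where
  "is_L2_sum a f \<longleftrightarrow>
     f \<in> borel_measurable sphere_measure \<and> L2norm f < \<infinity> \<and>
     (\<lambda>L. L2norm (\<lambda>x. f x - partial_synthesis a L x)) \<longlonglongrightarrow> 0"

(* The sum is determined up to null sets and exists for square-summable arrays, in particular
   whenever l1norm a is finite. Otherwise the value 0 is a dummy: l1norm a is then \<infinity>, and so
   is the objective below. *)
definition synthesis :: "(nat \<times> int \<Rightarrow> complex) \<Rightarrow> real ^ 3 \<Rightarrow> complex" where
  "synthesis a = (if \<exists>f. is_L2_sum a f then SOME f. is_L2_sum a f else (\<lambda>_. 0))"

definition residual_norm :: "(real ^ 3 \<Rightarrow> real) \<Rightarrow> (nat \<times> int \<Rightarrow> complex) \<Rightarrow> ennreal" where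
  "residual_norm t a = L2norm (\<lambda>x. of_real (t x) - synthesis a x)"

definition l1_objective ::
    "real \<Rightarrow> (real ^ 3 \<Rightarrow> real) \<Rightarrow> (nat \<times> int \<Rightarrow> complex) \<Rightarrow> ennreal" where
  "l1_objective lam t a = ennreal lam * l1norm a + (residual_norm t a)\<^sup>2 / 2"

definition minimizes_l1_objective ::
    "real \<Rightarrow> (real ^ 3 \<Rightarrow> real) \<Rightarrow> (nat \<times> int \<Rightarrow> complex) \<Rightarrow> bool" where
  "minimizes_l1_objective lam t = is_arg_min (l1_objective lam t) (\<lambda>a. a \<in> coef_arrays)"

definition l1_solution :: "real \<Rightarrow> (real ^ 3 \<Rightarrow> real) \<Rightarrow> nat \<times> int \<Rightarrow> complex" where
  "l1_solution lam t = arg_min (l1_objective lam t) (\<lambda>a. a \<in> coef_arrays)"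

(* \<sigma> is the standard deviation; constants count as Gaussian. *)
definition normal_law :: "real \<Rightarrow> real \<Rightarrow> real measure" where
  "normal_law \<mu> \<sigma> =
     (if \<sigma> = 0 then return borel \<mu> else density lborel (\<lambda>x. ennreal (normal_density \<mu> \<sigma> x)))"

definition gaussian_rv :: "'w measure \<Rightarrow> ('w \<Rightarrow> real) \<Rightarrow> bool" where
  "gaussian_rv M X \<longleftrightarrow>
     X \<in> borel_measurable M \<and> (\<exists>\<mu> \<sigma>. 0 \<le> \<sigma> \<and> distr M borel X = normal_law \<mu> \<sigma>)"

(* Only the values of T on S2 matter. *)
definition spherical_random_field :: "'w measure \<Rightarrow> ('w \<Rightarrow> real ^ 3 \<Rightarrow> real) \<Rightarrow> bool" where
  "spherical_random_field M T \<longleftrightarrow>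
     (\<lambda>(w, x). T w x) \<in> borel_measurable (M \<Otimes>\<^sub>M restrict_space borel S2)"

definition gaussian_field :: "'w measure \<Rightarrow> ('w \<Rightarrow> real ^ 3 \<Rightarrow> real) \<Rightarrow> bool" where
  "gaussian_field M T \<longleftrightarrow>
     (\<forall>F c. finite F \<and> F \<subseteq> S2 \<longrightarrow> gaussian_rv M (\<lambda>w. \<Sum>x\<in>F. c x * T w x))"

definition zero_mean_field :: "'w measure \<Rightarrow> ('w \<Rightarrow> real ^ 3 \<Rightarrow> real) \<Rightarrow> bool" where
  "zero_mean_field M T \<longleftrightarrow>
     (\<forall>x\<in>S2. integrable M (\<lambda>w. T w x) \<and> (\<integral>w. T w x \<partial>M) = 0)"

(* The law is the distribution on the product sigma-algebra of R^(S^2), which is equivalent to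
   all finite-dimensional distributions. *)
definition field_law :: "'w measure \<Rightarrow> ('w \<Rightarrow> real ^ 3 \<Rightarrow> real) \<Rightarrow> (real ^ 3 \<Rightarrow> real) measure" where
  "field_law M T = distr M (PiM S2 (\<lambda>_. borel)) (\<lambda>w. restrict (T w) S2)"

definition isotropic_field :: "'w measure \<Rightarrow> ('w \<Rightarrow> real ^ 3 \<Rightarrow> real) \<Rightarrow> bool" where
  "isotropic_field M T \<longleftrightarrow>
     (\<forall>g :: real ^ 3 ^ 3. rotation_matrix g \<longrightarrow>
        field_law M (\<lambda>w x. T w (g *v x)) = field_law M T)"

definition harmonic_coef :: "(real ^ 3 \<Rightarrow> real) \<Rightarrow> nat \<Rightarrow> int \<Rightarrow> complex" where
  "harmonic_coef t l m = (\<integral>x. of_real (t x) * cnj (sph_harm l m x) \<partial>sphere_measure)"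

(* The coefficient for m = 0 is real because sph_harm l 0 is. *)
definition angular_power_spectrum ::
    "'w measure \<Rightarrow> ('w \<Rightarrow> real ^ 3 \<Rightarrow> real) \<Rightarrow> (nat \<Rightarrow> real) \<Rightarrow> bool" where
  "angular_power_spectrum M T C \<longleftrightarrow>
     (\<forall>l. prob_space.variance M (\<lambda>w. Re (harmonic_coef (T w) l 0)) = C l \<and>
        (\<forall>m. m \<noteq> 0 \<and> \<bar>m\<bar> \<le> int l \<longrightarrow>
           prob_space.variance M (\<lambda>w. Re (harmonic_coef (T w) l m)) = C l / 2 \<and>
           prob_space.variance M (\<lambda>w. Im (harmonic_coef (T w) l m)) = C l / 2))"

end

theory Submission
  imports Defs
begin

text \<open>
  The second moment of \<open>T(x)\<close> is finite since \<open>T\<close> is Gaussian, and independent of \<open>x\<close> since \<open>T\<close> is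
  isotropic; so by Fubini almost every realization lies in
  \<open>L\<^sup>2(S\<^sup>2)\<close>. The spherical harmonics form a complete orthonormal system: orthogonality comes from
  the Legendre equation, completeness from Stone--Weierstrass, since their span on the sphere is the
  algebra of polynomials. By Parseval the objective splits into a sum over the coefficients \<open>c\<close> of
  \<open>T\<close>, and its unique minimizer is obtained by soft thresholding each of them. It has finite support,
  so completeness of \<open>L\<^sup>2\<close> is never needed. The squared residual is
  \<open>\<Sum> min (\<bar>c\<bar>, \<lambda>)\<^sup>2\<close>, which decreases to 0 as \<open>\<lambda> \<rightarrow> 0\<close> by dominated convergence; continuity of
  the probability along \<open>\<lambda> = 1/n\<close> gives the claim.
\<close>

section \<open>Legendre polynomials\<close>

text \<open>Several obstacles shape the proof. \<open>sph_harm\<close> is defined through the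
  discontinuous \<open>Arg\<close>, so continuity, orthogonality and products are all derived from
  its polynomial form on the sphere: a polynomial in x3 times a power of z = x1 + i x2 or of its
  conjugate. On the sphere z times its conjugate is 1 - x3^2, which is what closes the span under
  multiplication. Stone-Weierstrass reaches continuous functions only, so a separate density
  argument leads from these to square-integrable ones. One finite identity, the squared distance of
  t to a partial sum with arbitrary coefficients, yields Bessel's inequality, Parseval's equation
  and the residual of every array. Finally, the threshold has to be chosen before the realization,
  although the speed of convergence depends on the realization; the residual is monotone in the
  threshold, so the good events increase.\<close>

lemma higher_pderiv_X_mult:
  "(pderiv ^^ Suc n) ([:0, 1:] * f) =
     [:0, 1:] * (pderiv ^^ Suc n) f + smult (real (Suc n)) ((pderiv ^^ n) f)"
proof (induction n)
  case 0
  show ?case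
    by (simp add: pderiv_mult pderiv_pCons)
next
  case (Suc n)
  have "(pderiv ^^ Suc (Suc n)) ([:0, 1:] * f) = pderiv ((pderiv ^^ Suc n) ([:0, 1:] * f))"
    by simp
  also have "\<dots> = pderiv ([:0, 1:] * (pderiv ^^ Suc n) f + smult (real (Suc n)) ((pderiv ^^ n) f))"
    by (simp only: Suc.IH)
  also have "\<dots> = [:0, 1:] * (pderiv ^^ Suc (Suc n)) f
      + smult (real (Suc (Suc n))) ((pderiv ^^ Suc n) f)"
    by (simp add: poly_eq_poly_eq_iff[symmetric] fun_eq_iff pderiv_add pderiv_mult pderiv_smult
        pderiv_pCons algebra_simps)
  finally show ?case .
qed

text \<open>Leibniz' rule stops after three terms because the third derivative of t^2 - 1 vanishes.
  Orders are counted from 2 so that all indices on the right are genuine natural numbers.\<close>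

lemma higher_pderiv_quadratic_mult:
  "(pderiv ^^ Suc (Suc n)) ([:-1, 0, 1:] * f) =
     [:-1, 0, 1:] * (pderiv ^^ Suc (Suc n)) f
     + smult (2 * real (Suc (Suc n))) ([:0, 1:] * (pderiv ^^ Suc n) f)
     + smult (real (Suc (Suc n)) * real (Suc n)) ((pderiv ^^ n) f)"
proof (induction n)
  case 0
  show ?case
    by (simp add: poly_eq_poly_eq_iff[symmetric] fun_eq_iff pderiv_add pderiv_mult pderiv_smult
        pderiv_pCons algebra_simps del: mult_pCons_left mult_pCons_right)
next
  case (Suc n)
  have "(pderiv ^^ Suc (Suc (Suc n))) ([:-1, 0, 1:] * f)
      = pderiv ((pderiv ^^ Suc (Suc n)) ([:-1, 0, 1:] * f))"
    by simp
  also have "\<dots> = pderiv ([:-1, 0, 1:] * (pderiv ^^ Suc (Suc n)) f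
     + smult (2 * real (Suc (Suc n))) ([:0, 1:] * (pderiv ^^ Suc n) f)
     + smult (real (Suc (Suc n)) * real (Suc n)) ((pderiv ^^ n) f))"
    by (simp only: Suc.IH)
  also have "\<dots> = [:-1, 0, 1:] * (pderiv ^^ Suc (Suc (Suc n))) f
     + smult (2 * real (Suc (Suc (Suc n)))) ([:0, 1:] * (pderiv ^^ Suc (Suc n)) f)
     + smult (real (Suc (Suc (Suc n))) * real (Suc (Suc n))) ((pderiv ^^ Suc n) f)"
    by (simp add: poly_eq_poly_eq_iff[symmetric] fun_eq_iff pderiv_add pderiv_mult pderiv_smult
        pderiv_pCons algebra_simps del: mult_pCons_left mult_pCons_right)
  finally show ?case .
qed

text \<open>Differentiate the identity \<open>(t\<^sup>2 - 1) u' = 2 l t u\<close> for \<open>u = (t\<^sup>2 - 1)\<^sup>l\<close> exactly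
  \<open>l + m + 1\<close> times.\<close>

lemma legendre_ode:
  fixes l m :: nat
  defines "v \<equiv> \<lambda>m. (pderiv ^^ m) (legendre_poly l)"
  shows "[:-1, 0, 1:] * v (m + 2) + smult (2 * (real m + 1)) ([:0, 1:] * v (m + 1))
     = smult ((real l - real m) * (real l + real m + 1)) (v m)"
proof -
  define u :: "real poly" where "u = [:-1, 0, 1:] ^ l"
  define c :: real where "c = 1 / (2 ^ l * fact l)"
  define y where "y k = poly ((pderiv ^^ (l + k)) u)" for k
  have v: "v k = smult c ((pderiv ^^ (l + k)) u)" for k
    by (simp add: v_def legendre_poly_def higher_pderiv_smult u_def c_def funpow_add add.commute[of l])
  have base: "[:-1, 0, 1:] * pderiv u = smult (2 * real l) ([:0, 1:] * u)"
  proof (cases l)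
    case (Suc k)
    then show ?thesis
      unfolding u_def by (simp add: poly_eq_poly_eq_iff[symmetric] fun_eq_iff pderiv_power_Suc pderiv_pCons
          algebra_simps del: power_Suc) (simp add: algebra_simps)
  qed (simp add: u_def)
  have x: "poly p x = poly q x" if "p = q" for p q :: "real poly" and x
    using that by simp
  have *: "(x\<^sup>2 - 1) * y (m + 2) x + 2 * (real m + 1) * x * y (m + 1) x
      = (real l - real m) * (real l + real m + 1) * y m x" for x
  \<comment> \<open>The order l + m + 1 of differentiation is written as \<open>Suc (Suc n)\<close>,
    so n = l + m - 1. This leaves out l = m = 0, where u = 1 and both sides vanish.\<close>
  proof (cases "l + m")
    case 0
    then show ?thesis
      by (simp add: y_def u_def)
  next
    case (Suc n)
    have lm: "real l + real m = real n + 1"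
      using Suc by (metis of_nat_Suc of_nat_add add.commute)
    have L: "(pderiv ^^ Suc (Suc n)) ([:-1, 0, 1:] * pderiv u)
        = smult (2 * real l) ((pderiv ^^ Suc (Suc n)) ([:0, 1:] * u))"
      by (simp only: base higher_pderiv_smult)
    have s: "pderiv u = (pderiv ^^ 1) u" by simp
    have e: "(pderiv ^^ k) (pderiv u) = (pderiv ^^ Suc k) u" for k
      by (simp only: s funpow_add[symmetric, THEN fun_cong, unfolded comp_def]) simp
    have idx: "y (m + 2) = poly ((pderiv ^^ Suc (Suc (Suc n))) u)"
      "y (m + 1) = poly ((pderiv ^^ Suc (Suc n)) u)"
      "y m = poly ((pderiv ^^ Suc n) u)"
      using Suc by (simp_all only: y_def add.assoc[symmetric]) (simp_all add: numeral_2_eq_2)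
    from x[OF L, of x]
    have "(x\<^sup>2 - 1) * y (m + 2) x + 2 * (real n + 2) * x * y (m + 1) x + (real n + 2) * (real n + 1) * y m x
       = 2 * real l * (x * y (m + 1) x + (real n + 2) * y m x)"
      unfolding higher_pderiv_quadratic_mult higher_pderiv_X_mult e poly_add poly_mult poly_smult
        idx[symmetric]
      by (simp add: algebra_simps power2_eq_square)
    moreover have n: "real n = real l + real m - 1"
      using lm by simp
    ultimately show ?thesis
      unfolding n by (simp add: algebra_simps)
  qed
  show ?thesis
    unfolding v poly_eq_poly_eq_iff[symmetric] fun_eq_iff
  proof
    fix x
    show "poly ([:-1, 0, 1:] * smult c ((pderiv ^^ (l + (m + 2))) u)
       + smult (2 * (real m + 1)) ([:0, 1:] * smult c ((pderiv ^^ (l + (m + 1))) u))) x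
     = poly (smult ((real l - real m) * (real l + real m + 1))
         (smult c ((pderiv ^^ (l + m)) u))) x"
    proof -
      have "c * ((x\<^sup>2 - 1) * y (m + 2) x + 2 * (real m + 1) * x * y (m + 1) x)
          = c * ((real l - real m) * (real l + real m + 1) * y m x)"
        by (simp only: *)
      then show ?thesis
        unfolding y_def poly_add poly_mult poly_smult
        by (simp only: poly_pCons poly_0 power2_eq_square algebra_simps)
    qed
  qed
qed

lemma degree_legendre_poly: "degree (legendre_poly l) = l"
  by (simp add: legendre_poly_def degree_higher_pderiv degree_power_eq)

lemma higher_pderiv_degree:
  fixes p :: "real poly"
  assumes "degree p = n"
  shows "(pderiv ^^ n) p = [:fact n * lead_coeff p:]"
proof -
  have "degree ((pderiv ^^ n) p) = 0"
    by (simp add: degree_higher_pderiv assms)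
  moreover have "coeff ((pderiv ^^ n) p) 0 = fact n * lead_coeff p"
    by (simp add: coeff_higher_pderiv assms pochhammer_fact)
  ultimately show ?thesis
    by (metis degree_0_id)
qed

text \<open>By Rodrigues' formula this is the derivative of order 2 l of a monic polynomial of
  degree 2 l. The constant fixes the norm in the case m = l; being nonzero, it also shows that lower
  derivatives do not vanish.\<close>

lemma higher_pderiv_legendre_poly_self:
  "(pderiv ^^ l) (legendre_poly l) = [:fact (2 * l) / (2 ^ l * fact l):]"
proof -
  have "degree (([:-1, 0, 1:] :: real poly) ^ l) = 2 * l"
    by (simp add: degree_power_eq)
  moreover have "lead_coeff (([:-1, 0, 1:] :: real poly) ^ l) = 1"
    unfolding lead_coeff_power by simp
  ultimately have "(pderiv ^^ (l + l)) (([:-1, 0, 1:] :: real poly) ^ l) = [:fact (2 * l):]"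
    using higher_pderiv_degree[of "([:-1, 0, 1:] :: real poly) ^ l" "2 * l"] by (simp add: mult_2)
  then show ?thesis
    by (simp add: legendre_poly_def higher_pderiv_smult funpow_add)
qed

section \<open>Integrals over [-1, 1] and the norms of associated Legendre functions\<close>

text \<open>This is \<open>\<integral>p\<close> over \<open>[-1, 1]\<close>, after the substitution \<open>t = cos \<theta>\<close>.\<close>

definition polar_integral :: "real poly \<Rightarrow> real" where
  "polar_integral p = (\<integral>\<theta>. indicator {0..pi} \<theta> *\<^sub>R (sin \<theta> * poly p (cos \<theta>)) \<partial>lborel)"

lemma integrable_polar:
  "integrable lborel (\<lambda>\<theta>. indicator {0..pi} \<theta> *\<^sub>R (sin \<theta> * poly p (cos \<theta>)))"
  unfolding set_integrable_def[symmetric]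
  by (intro borel_integrable_atLeastAtMost' continuous_intros)

lemma polar_integral_pderiv: "polar_integral (pderiv p) = poly p 1 - poly p (-1)"
proof -
  have "polar_integral (pderiv p) = - poly p (cos pi) - (- poly p (cos 0))"
    unfolding polar_integral_def
  proof (rule integral_FTC_atLeastAtMost)
    show "((\<lambda>\<theta>. - poly p (cos \<theta>)) has_vector_derivative sin x * poly (pderiv p) (cos x)) (at x within {0..pi})"
      for x unfolding has_real_derivative_iff_has_vector_derivative[symmetric]
      by (auto intro!: derivative_eq_intros)
  qed (auto intro!: continuous_intros)
  then show ?thesis by simp
qed

lemma polar_integral_add: "polar_integral (p + q) = polar_integral p + polar_integral q"
  unfolding polar_integral_def Bochner_Integration.integral_add[OF integrable_polar integrable_polar, symmetric]
  by (rule Bochner_Integration.integral_cong) (auto simp: algebra_simps)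

lemma polar_integral_smult: "polar_integral (smult c p) = c * polar_integral p"
proof -
  have "polar_integral (smult c p) =
      (\<integral>\<theta>. c * (indicator {0..pi} \<theta> *\<^sub>R (sin \<theta> * poly p (cos \<theta>))) \<partial>lborel)"
    unfolding polar_integral_def
    by (rule Bochner_Integration.integral_cong) (auto simp: algebra_simps)
  then show ?thesis
    unfolding polar_integral_def by simp
qed

lemma polar_integral_parts:
  assumes "poly p 1 = 0" "poly p (-1) = 0"
  shows "polar_integral (p * pderiv q) = - polar_integral (pderiv p * q)"
  using polar_integral_pderiv[of "p * q"] assms
  by (simp add: pderiv_mult polar_integral_add mult.commute)

text \<open>Writing 1 as the derivative of t and integrating by parts gives the recursion (2 l + 3)
  J (l + 1) = 2 (l + 1) J l for this Beta integral.\<close>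

lemma polar_integral_power:
  "polar_integral ([:1, 0, -1:] ^ l) = 2 ^ (2 * l + 1) * (fact l)\<^sup>2 / fact (2 * l + 1)"
proof (induction l)
  case 0
  have "polar_integral 1 = polar_integral (pderiv [:0, 1:])"
    by (simp add: pderiv_pCons one_pCons)
  then show ?case
    unfolding polar_integral_pderiv by simp
next
  case (Suc l)
  let ?U = "[:1, 0, -1:] :: real poly" and ?J = "\<lambda>l. polar_integral ([:1, 0, -1:] ^ l)"
  have "?J (Suc l) = polar_integral (?U ^ Suc l * pderiv [:0, 1:])"
    by (simp add: pderiv_pCons del: power_Suc)
  also have "\<dots> = - polar_integral (pderiv (?U ^ Suc l) * [:0, 1:])"
    by (rule polar_integral_parts) (simp_all add: poly_power)
  \<comment> \<open>The factor t^2 produced here equals 1 - U, which leads back to powers of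
    U.\<close>
  also have "pderiv (?U ^ Suc l) * [:0, 1:]
      = smult (2 * real (Suc l)) (?U ^ Suc l) + smult (- 2 * real (Suc l)) (?U ^ l)"
    by (simp add: poly_eq_poly_eq_iff[symmetric] fun_eq_iff pderiv_power_Suc pderiv_pCons poly_power
          algebra_simps del: power_Suc) (simp add: algebra_simps)
  finally have "(2 * real l + 3) * ?J (Suc l) = 2 * (real l + 1) * ?J l"
    unfolding polar_integral_add polar_integral_smult by (simp add: algebra_simps)
  then have "?J (Suc l) = 2 * (real l + 1) / (2 * real l + 3) * ?J l"
    by (simp add: field_simps)
  also have "\<dots> = 2 ^ (2 * Suc l + 1) * (fact (Suc l))\<^sup>2 / fact (2 * Suc l + 1)"
  proof -
    have f: "fact (2 * Suc l + 1) = (2 * real l + 3) * (2 * (real l + 1)) * fact (2 * l + 1)"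
      by (simp add: algebra_simps)
    have g: "fact (Suc l) = (real l + 1) * fact l"
      by (simp add: algebra_simps)
    show ?thesis
      unfolding Suc.IH f g by (simp add: power2_eq_square divide_simps del: fact_Suc)
        (simp add: algebra_simps)
  qed
  finally show ?case .
qed

text \<open>The integral over [-1, 1] of the product of two associated Legendre functions of the
  same order: their square roots multiply to the polynomial weight (1 - t^2)^m and their phases
  (-1)^m cancel.\<close>

definition legendre_pairing :: "nat \<Rightarrow> nat \<Rightarrow> nat \<Rightarrow> real" where
  "legendre_pairing m l l' = polar_integral
     ([:1, 0, -1:] ^ m * (pderiv ^^ m) (legendre_poly l) * (pderiv ^^ m) (legendre_poly l'))"

text \<open>The Legendre equation in Sturm-Liouville form says that (1 - t^2)^(m + 1) v^(m + 1) has
  derivative -c (1 - t^2)^m v^(m), with upper indices of v denoting derivatives. Integration by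
  parts has no boundary terms because of the weight. Orthogonality and norms both come out of this
  one recursion.\<close>

lemma legendre_pairing_Suc:
  "legendre_pairing (Suc m) l l' = (real l - real m) * (real l + real m + 1) * legendre_pairing m l l'"
proof -
  let ?U = "[:1, 0, -1:] :: real poly"
  let ?v = "\<lambda>m. (pderiv ^^ m) (legendre_poly l)" and ?w = "\<lambda>m. (pderiv ^^ m) (legendre_poly l')"
  let ?c = "(real l - real m) * (real l + real m + 1)"
  have d: "pderiv (?U ^ Suc m * ?v (Suc m)) = smult (- ?c) (?U ^ m * ?v m)"
  proof -
    have "poly (pderiv (?U ^ Suc m * ?v (Suc m))) x = poly (smult (- ?c) (?U ^ m * ?v m)) x" for x
    proof -
      have "poly (pderiv (?U ^ Suc m * ?v (Suc m))) x
         = - ((1 - x\<^sup>2) ^ m) * ((x\<^sup>2 - 1) * poly (?v (m + 2)) x + 2 * (real m + 1) * x * poly (?v (m + 1)) x)"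
        by (simp add: pderiv_mult pderiv_power_Suc pderiv_pCons poly_power algebra_simps power2_eq_square
            del: power_Suc) (simp add: algebra_simps power2_eq_square)
      also have "(x\<^sup>2 - 1) * poly (?v (m + 2)) x + 2 * (real m + 1) * x * poly (?v (m + 1)) x = ?c * poly (?v m) x"
        using arg_cong[OF legendre_ode[of m l], of "\<lambda>p. poly p x"]
        by (simp add: algebra_simps power2_eq_square)
      finally show ?thesis
        by (simp add: poly_power power2_eq_square)
    qed
    then show ?thesis
      by (simp add: poly_eq_poly_eq_iff[symmetric] fun_eq_iff)
  qed
  have "legendre_pairing (Suc m) l l' = polar_integral ((?U ^ Suc m * ?v (Suc m)) * pderiv (?w m))"
    by (simp add: legendre_pairing_def)
  also have "\<dots> = - polar_integral (pderiv (?U ^ Suc m * ?v (Suc m)) * ?w m)"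
    by (rule polar_integral_parts) (simp_all add: poly_power)
  finally show ?thesis
    unfolding d legendre_pairing_def mult_smult_left polar_integral_smult by simp
qed

lemma legendre_pairing_sym: "legendre_pairing m l l' = legendre_pairing m l' l"
  by (simp add: legendre_pairing_def mult_ac)

text \<open>The factors of the recursion telescope to a quotient of factorials.\<close>

lemma legendre_pairing_eq_0_pairing:
  assumes "m \<le> l"
  shows "legendre_pairing m l l' = fact (l + m) / fact (l - m) * legendre_pairing 0 l l'"
  using assms
proof (induction m)
  case (Suc m)
  then have "l - m = Suc (l - Suc m)"
    by simp
  then have "(fact (l - m) :: real) = (real l - real m) * fact (l - Suc m)"
    using Suc.prems by (simp add: of_nat_diff)
  then have "fact (l + Suc m) / fact (l - Suc m)
      = (real l - real m) * (real l + real m + 1) * (fact (l + m) / fact (l - m) :: real)"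
    using Suc.prems by (simp add: divide_simps)
  then show ?case
    using Suc by (simp add: legendre_pairing_Suc)
qed simp

text \<open>The pairing of order 1 is symmetric, yet the recursion expresses it through the pairing
  of order 0 with factor l (l + 1) or, after exchanging the degrees, l' (l' + 1). These factors
  differ, so the pairing of order 0 vanishes, and with it all the others.\<close>

lemma legendre_pairing_orthogonal:
  assumes "l \<noteq> l'" "m \<le> l"
  shows "legendre_pairing m l l' = 0"
proof -
  have "real l * (real l + 1) * legendre_pairing 0 l l' = real l' * (real l' + 1) * legendre_pairing 0 l l'"
    using legendre_pairing_Suc[of 0 l l'] legendre_pairing_Suc[of 0 l' l]
    by (simp only: legendre_pairing_sym[of _ l' l] of_nat_0 diff_0_right add_0_right)
  then have "(real l - real l') * (real l + real l' + 1) * legendre_pairing 0 l l' = 0"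
    by (simp only: left_diff_distrib distrib_left distrib_right) (simp add: algebra_simps)
  moreover have "real l - real l' \<noteq> 0" "real l + real l' + 1 \<noteq> 0"
    using assms(1) by simp_all
  ultimately have "legendre_pairing 0 l l' = 0"
    by simp
  then show ?thesis
    using legendre_pairing_eq_0_pairing[OF assms(2)] by simp
qed

text \<open>At m = l the derivatives are constants and the pairing is a multiple of the integral of
  (1 - t^2)^l. The recursion carries this value down to order 0 and from there up to order
  m.\<close>

lemma legendre_pairing_self:
  assumes "m \<le> l"
  shows "legendre_pairing m l l = 2 / (2 * real l + 1) * (fact (l + m) / fact (l - m))"
proof -
  let ?c = "fact (2 * l) / (2 ^ l * fact l) :: real"
  have "legendre_pairing l l l = polar_integral (smult (?c\<^sup>2) ([:1, 0, -1:] ^ l))"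
    by (simp add: legendre_pairing_def higher_pderiv_legendre_poly_self power2_eq_square)
  also have "\<dots> = ?c\<^sup>2 * (2 ^ (2 * l + 1) * (fact l)\<^sup>2 / fact (2 * l + 1))"
    by (simp only: polar_integral_smult polar_integral_power)
  also have "\<dots> = fact (2 * l) * (2 / (2 * real l + 1))"
  proof -
    have 1: "fact (2 * l + 1) = (2 * real l + 1) * fact (2 * l)"
      and 2: "(2::real) ^ (2 * l + 1) = 2 * (2 ^ l)\<^sup>2"
      by (simp_all add: power_mult[symmetric] mult.commute)
    have "(a / (b * d))\<^sup>2 * (2 * b\<^sup>2 * d\<^sup>2 / (k * a)) = a * (2 / k)"
      if "a \<noteq> 0" "b \<noteq> 0" "d \<noteq> 0" for a b d k :: real
      using that by (simp add: power2_eq_square)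
    note * = this
    show ?thesis
      unfolding 1 2 by (rule *) simp_all
  qed
  finally have "fact (2 * l) * legendre_pairing 0 l l = fact (2 * l) * (2 / (2 * real l + 1))"
    unfolding legendre_pairing_eq_0_pairing[OF order_refl] by (simp only: mult_2[symmetric] diff_self_eq_0 fact_0 div_by_1)
  then have "legendre_pairing 0 l l = 2 / (2 * real l + 1)"
    by (metis fact_nonzero mult_left_cancel)
  then show ?thesis
    using legendre_pairing_eq_0_pairing[OF assms] by simp
qed

section \<open>Spherical harmonics on the sphere\<close>

lemma S2_iff: "x \<in> S2 \<longleftrightarrow> (x $ 1)\<^sup>2 + (x $ 2)\<^sup>2 + (x $ 3)\<^sup>2 = 1" for x :: "real ^ 3"
  by (simp add: S2_def norm_eq_1 inner_vec_def sum_3 power2_eq_square)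

lemma compact_S2: "compact S2"
  by (simp add: S2_def)

lemma sphere_point_component [simp]:
  "sphere_point (\<theta>, \<phi>) $ 1 = sin \<theta> * cos \<phi>"
  "sphere_point (\<theta>, \<phi>) $ 2 = sin \<theta> * sin \<phi>"
  "sphere_point (\<theta>, \<phi>) $ 3 = cos \<theta>"
  by (simp_all add: sphere_point_def)

lemma sphere_point_in_S2: "sphere_point p \<in> S2"
proof (cases p)
  case (Pair \<theta> \<phi>)
  have "(sin \<theta> * cos \<phi>)\<^sup>2 + (sin \<theta> * sin \<phi>)\<^sup>2 + (cos \<theta>)\<^sup>2 = (sin \<theta>)\<^sup>2 * ((sin \<phi>)\<^sup>2 + (cos \<phi>)\<^sup>2) + (cos \<theta>)\<^sup>2"
    by (simp only: power_mult_distrib distrib_left add_ac)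
  also have "\<dots> = 1"
    by simp
  finally show ?thesis
    unfolding S2_iff Pair sphere_point_component .
qed

lemma continuous_on_sphere_point: "continuous_on A sphere_point"
proof -
  have *: "sphere_point = (\<lambda>p. (sin (fst p) * cos (snd p)) *\<^sub>R axis 1 1
      + (sin (fst p) * sin (snd p)) *\<^sub>R axis 2 1 + cos (fst p) *\<^sub>R axis 3 1)"
    by (auto simp: fun_eq_iff vec_eq_iff forall_3 axis_def)
  show ?thesis
    by (subst *) (intro continuous_intros)
qed

section \<open>The surface measure and integration in polar coordinates\<close>

lemma space_sphere_measure [simp]: "space sphere_measure = S2"
  by (simp add: sphere_measure_def space_restrict_space)

lemma sets_sphere_measure [measurable_cong]: "sets sphere_measure = sets (restrict_space borel S2)"
  by (simp add: sphere_measure_def)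

text \<open>A real-valued density, as Bochner integrals require, arranged as a product of a function
  of each angle so that Fubini separates the variables.\<close>

definition polar_weight :: "real \<times> real \<Rightarrow> real" where
  "polar_weight p = (indicator {0..pi} (fst p) * sin (fst p)) * indicator {0..2 * pi} (snd p)"

lemma polar_weight_nonneg: "0 \<le> polar_weight p"
  by (auto simp: polar_weight_def indicator_def sin_ge_zero)

lemma measurable_polar_weight [measurable]: "polar_weight \<in> borel_measurable borel"
proof -
  have [measurable]: "(sin :: real \<Rightarrow> real) \<in> borel_measurable borel"
    by (intro borel_measurable_continuous_onI continuous_intros)
  show ?thesis
    unfolding polar_weight_def borel_prod[symmetric] by measurable
qed

lemma sphere_measure_altdef:
  "sphere_measure = distr (density lborel (\<lambda>p. ennreal (polar_weight p))) (restrict_space borel S2) sphere_point"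
proof -
  have "(\<lambda>(\<theta>, \<phi>). ennreal (sin \<theta>) * indicator ({0..pi} \<times> {0..2 * pi}) (\<theta>, \<phi>))
      = (\<lambda>p. ennreal (polar_weight p))"
    by (auto simp: fun_eq_iff polar_weight_def indicator_def)
  then show ?thesis
    by (simp add: sphere_measure_def)
qed

lemma measurable_sphere_point [measurable]: "sphere_point \<in> measurable borel (restrict_space borel S2)"
  by (intro measurable_restrict_space2 borel_measurable_continuous_onI continuous_on_sphere_point)
    (auto intro: sphere_point_in_S2)

lemma finite_sphere_measure: "finite_measure sphere_measure"
proof
  have [simp]: "sphere_point -` S2 = UNIV"
    by (auto intro: sphere_point_in_S2)
  have "emeasure sphere_measure (space sphere_measure)
      = (\<integral>\<^sup>+p. ennreal (polar_weight p) \<partial>lborel)"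
    unfolding space_sphere_measure
    by (subst sphere_measure_altdef, subst emeasure_distr)
      (auto simp: emeasure_density sphere_point_in_S2 sets_restrict_space intro!: nn_integral_cong)
  also have "\<dots> \<le> (\<integral>\<^sup>+p. indicator ({0..pi} \<times> {0..2 * pi}) p \<partial>lborel)"
    by (intro nn_integral_mono) (auto simp: polar_weight_def indicator_def)
  also have "\<dots> = emeasure lborel ({0..pi} \<times> {0..2 * pi} :: (real \<times> real) set)"
    by (intro nn_integral_indicator) (simp add: borel_prod[symmetric])
  also have "\<dots> < \<infinity>"
    by (intro emeasure_bounded_finite bounded_Times) auto
  finally show "emeasure sphere_measure (space sphere_measure) \<noteq> \<infinity>"
    by simp
qed

interpretation sphere: finite_measure sphere_measure
  by (rule finite_sphere_measure)

lemma borel_measurable_sphere_cont: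
  fixes f :: "real ^ 3 \<Rightarrow> 'b::topological_space"
  assumes "continuous_on S2 f"
  shows "f \<in> borel_measurable sphere_measure"
  using borel_measurable_continuous_on_restrict[OF assms]
  by (simp cong: measurable_cong_sets add: sets_sphere_measure)

lemma integrable_sphere_cont:
  fixes f :: "real ^ 3 \<Rightarrow> 'b::{banach, second_countable_topology}"
  assumes "continuous_on S2 f"
  shows "integrable sphere_measure f"
proof -
  obtain B where "\<And>x. x \<in> S2 \<Longrightarrow> norm (f x) \<le> B"
    using compact_imp_bounded[OF compact_continuous_image[OF assms compact_S2]]
    by (auto simp: bounded_iff)
  then show ?thesis
    by (intro sphere.integrable_const_bound[of _ B] borel_measurable_sphere_cont assms) auto
qed

lemma integral_product_separated:
  fixes a :: "real \<Rightarrow> real" and b :: "real \<Rightarrow> complex"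
  assumes a: "integrable lborel a" and b: "integrable lborel b"
  shows "(\<integral>p. a (fst p) *\<^sub>R b (snd p) \<partial>lborel) = (\<integral>x. a x \<partial>lborel) *\<^sub>R (\<integral>y. b y \<partial>lborel)"
proof -
  note [measurable] = borel_measurable_integrable[OF a] borel_measurable_integrable[OF b]
  have "integrable (lborel \<Otimes>\<^sub>M lborel) (\<lambda>p. a (fst p) *\<^sub>R b (snd p))"
    using a b by (intro lborel_pair.Fubini_integrable) (auto intro!: integrable_mult_left)
  from lborel_pair.integral_fst'[OF this] show ?thesis
    by (simp add: lborel_prod a)
qed

lemma integral_cis:
  fixes k :: int
  shows "(\<integral>\<phi>. indicator {0..2 * pi} \<phi> *\<^sub>R cis (of_int k * \<phi>) \<partial>lborel) = (if k = 0 then 2 * pi else 0)"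
proof (cases "k = 0")
  case True
  have "(\<integral>\<phi>. indicator {0..2 * pi} \<phi> *\<^sub>R (1 :: complex) \<partial>lborel) = of_real (2 * pi) - of_real 0"
    by (rule integral_FTC_atLeastAtMost) (auto intro!: derivative_eq_intros)
  then show ?thesis
    using True by simp
next
  case False
  have "(\<integral>\<phi>. indicator {0..2 * pi} \<phi> *\<^sub>R cis (of_int k * \<phi>) \<partial>lborel)
    = cis (of_int k * (2 * pi)) / (\<i> * of_int k) - cis (of_int k * 0) / (\<i> * of_int k)"
  proof (rule integral_FTC_atLeastAtMost)
    fix x :: real
    have "((\<lambda>t. exp (\<i> * of_int k * of_real t) / (\<i> * of_int k)) has_vector_derivative
        exp (\<i> * of_int k * of_real x)) (at x within {0..2 * pi})"
      using False by (intro has_vector_derivative_real_field) (auto intro!: derivative_eq_intros)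
    then show "((\<lambda>t. cis (of_int k * t) / (\<i> * of_int k)) has_vector_derivative cis (of_int k * x))
        (at x within {0..2 * pi})"
      by (simp add: cis_conv_exp mult.assoc)
  qed (auto intro!: continuous_intros)
  also have "cis (of_int k * (2 * pi)) = 1"
    using cis_power_int[of "2 * pi" k] by simp
  finally show ?thesis
    using False by simp
qed

text \<open>After the change to polar coordinates the integral is a product, and its azimuthal
  factor is a full period of exp (i k \<phi>).\<close>

lemma integral_sphere_separated:
  fixes f :: "real ^ 3 \<Rightarrow> complex" and g :: "real \<Rightarrow> real" and k :: int
  assumes f: "continuous_on S2 f" and g: "continuous_on {0..pi} g"
    and fg: "\<And>\<theta> \<phi>. \<theta> \<in> {0..pi} \<Longrightarrow> f (sphere_point (\<theta>, \<phi>)) = of_real (g \<theta>) * cis (of_int k * \<phi>)"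
  shows "(\<integral>x. f x \<partial>sphere_measure)
     = (if k = 0 then 2 * pi * (\<integral>\<theta>. indicator {0..pi} \<theta> *\<^sub>R (sin \<theta> * g \<theta>) \<partial>lborel) else 0)"
proof -
  have [measurable]: "f \<in> borel_measurable (restrict_space borel S2)"
    by (rule borel_measurable_continuous_on_restrict[OF f])
  have i1: "integrable lborel (\<lambda>\<theta>. indicator {0..pi} \<theta> *\<^sub>R (sin \<theta> * g \<theta>))"
    unfolding set_integrable_def[symmetric] using g
    by (intro borel_integrable_atLeastAtMost' continuous_intros)
  have i2: "integrable lborel (\<lambda>\<phi>. indicator {0..2 * pi} \<phi> *\<^sub>R cis (of_int k * \<phi>))"
    unfolding set_integrable_def[symmetric]
    by (intro borel_integrable_atLeastAtMost' continuous_intros)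
  have [measurable]: "(\<lambda>p. f (sphere_point p)) \<in> borel_measurable borel"
    by measurable
  have "(\<integral>x. f x \<partial>sphere_measure) = (\<integral>p. polar_weight p *\<^sub>R f (sphere_point p) \<partial>lborel)"
    unfolding sphere_measure_altdef
    by (subst integral_distr) (auto simp: polar_weight_nonneg integral_density)
  also have "\<dots> = (\<integral>p. (indicator {0..pi} (fst p) *\<^sub>R (sin (fst p) * g (fst p))) *\<^sub>R
      (indicator {0..2 * pi} (snd p) *\<^sub>R cis (of_int k * snd p)) \<partial>lborel)"
    by (intro Bochner_Integration.integral_cong)
      (auto simp: polar_weight_def indicator_def fg scaleR_conv_of_real)
  also have "\<dots> = (\<integral>\<theta>. indicator {0..pi} \<theta> *\<^sub>R (sin \<theta> * g \<theta>) \<partial>lborel) *\<^sub>R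
      (\<integral>\<phi>. indicator {0..2 * pi} \<phi> *\<^sub>R cis (of_int k * \<phi>) \<partial>lborel)"
    by (rule integral_product_separated[OF i1 i2])
  finally show ?thesis
    unfolding integral_cis by (simp add: scaleR_conv_of_real mult.commute)
qed

section \<open>Polynomial form and orthonormality of the harmonics\<close>

definition harmonic_const :: "nat \<Rightarrow> nat \<Rightarrow> real" where
  "harmonic_const l m = sqrt ((2 * real l + 1) / (4 * pi) * (fact (l - m) / fact (l + m)))"

lemma harmonic_const_pos: "0 < harmonic_const l m"
  by (simp add: harmonic_const_def)

text \<open>On the sphere \<open>x\<^sub>1 + i x\<^sub>2\<close> has modulus \<open>sqrt (1 - x\<^sub>3\<^sup>2)\<close>, so the factor in the
  argument of \<open>x\<^sub>1 + i x\<^sub>2\<close> combines with \<open>(1 - x\<^sub>3\<^sup>2)\<^bsup>m/2\<^esup>\<close> to a polynomial.\<close>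

lemma sph_harm_nonneg_eq:
  assumes "x \<in> S2"
  shows "sph_harm_nonneg l m x =
    of_real (harmonic_const l m * (-1) ^ m * poly ((pderiv ^^ m) (legendre_poly l)) (x $ 3))
      * Complex (x $ 1) (x $ 2) ^ m"
proof -
  let ?z = "Complex (x $ 1) (x $ 2)"
  have "cmod ?z = sqrt (1 - (x $ 3)\<^sup>2)"
    using assms by (simp add: S2_iff cmod_def algebra_simps)
  moreover have "?z = of_real (cmod ?z) * cis (Arg ?z)"
    using rcis_cmod_Arg[of ?z] by (simp only: rcis_def)
  then have "?z ^ m = of_real (cmod ?z) ^ m * cis (Arg ?z) ^ m"
    by (simp only: power_mult_distrib[symmetric])
  ultimately have "?z ^ m = of_real (sqrt (1 - (x $ 3)\<^sup>2) ^ m) * cis (real m * Arg ?z)"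
    by (simp only: Complex.DeMoivre of_real_power)
  then show ?thesis
    by (simp add: sph_harm_nonneg_def assoc_legendre_def harmonic_const_def)
qed

text \<open>The defining formula contains \<open>Arg\<close>, which jumps across the negative real
  axis. The polynomial form, valid on the sphere, is visibly continuous.\<close>

lemma continuous_on_sph_harm: "continuous_on S2 (sph_harm l m)"
proof -
  have "continuous_on S2 (\<lambda>x. sph_harm_nonneg l k x)" for k
    by (subst continuous_on_cong[OF refl sph_harm_nonneg_eq])
      (auto simp: Complex_eq intro!: continuous_intros)
  then show ?thesis
    unfolding sph_harm_def by (cases "0 \<le> m") (auto intro!: continuous_intros)
qed

text \<open>For negative m the sign in \<open>sph_harm\<close> cancels the Condon-Shortley phase, so
  a sign survives only for m \<ge> 0. Going through the polynomial form makes the formula valid for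
  all \<theta>, also where sin \<theta> is negative.\<close>

lemma sph_harm_sphere_point:
  assumes "\<bar>m\<bar> \<le> int l"
  shows "sph_harm l m (sphere_point (\<theta>, \<phi>)) =
     of_real ((if 0 \<le> m then (-1) ^ nat \<bar>m\<bar> else 1) * harmonic_const l (nat \<bar>m\<bar>)
        * poly ((pderiv ^^ nat \<bar>m\<bar>) (legendre_poly l)) (cos \<theta>) * sin \<theta> ^ nat \<bar>m\<bar>) * cis (of_int m * \<phi>)"
proof -
  have *: "Complex (sin \<theta> * cos \<phi>) (sin \<theta> * sin \<phi>) = of_real (sin \<theta>) * cis \<phi>"
    by (simp add: complex_eq_iff)
  have nonneg: "sph_harm_nonneg l k (sphere_point (\<theta>, \<phi>)) =
      of_real ((-1) ^ k * harmonic_const l k * poly ((pderiv ^^ k) (legendre_poly l)) (cos \<theta>)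
        * sin \<theta> ^ k) * cis (real k * \<phi>)" for k
    unfolding sph_harm_nonneg_eq[OF sphere_point_in_S2] sphere_point_component * power_mult_distrib Complex.DeMoivre
    by simp
  show ?thesis
  proof (cases "0 \<le> m")
    case True
    then show ?thesis
      by (simp add: sph_harm_def nonneg)
  next
    case False
    have "cnj (cis (real (nat (- m)) * \<phi>)) = cis (of_int m * \<phi>)"
      using False by (simp add: cis_cnj)
    moreover have "(-1) ^ nat (- m) * ((-1) ^ nat (- m) * z) = (z :: complex)" for z
      by (simp add: mult.assoc[symmetric] power_mult_distrib[symmetric])
    ultimately show ?thesis
      using False by (simp add: sph_harm_def nonneg mult.assoc)
  qed
qed

text \<open>Different orders are separated by the azimuthal factor. For equal orders the powers of
  sin \<theta> combine to (1 - cos^2 \<theta>)^|m|, which is the weight of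
  \<open>legendre_pairing\<close>; its value, the normalising constants and the azimuthal 2 pi
  multiply to 1.\<close>

lemma sph_harm_orthonormal:
  assumes m: "\<bar>m\<bar> \<le> int l" and m': "\<bar>m'\<bar> \<le> int l'"
  shows "(\<integral>x. sph_harm l m x * cnj (sph_harm l' m' x) \<partial>sphere_measure) = (if l = l' \<and> m = m' then 1 else 0)"
proof -
  let ?s = "\<lambda>m::int. if 0 \<le> m then (-1) ^ nat \<bar>m\<bar> else (1::real)"
  let ?a = "nat \<bar>m\<bar>" and ?a' = "nat \<bar>m'\<bar>"
  let ?D = "\<lambda>m l. (pderiv ^^ nat \<bar>m\<bar>) (legendre_poly l)"
  define g where "g \<theta> = (?s m * ?s m' * harmonic_const l ?a * harmonic_const l' ?a')
      * (poly (?D m l) (cos \<theta>) * poly (?D m' l') (cos \<theta>) * sin \<theta> ^ (?a + ?a'))" for \<theta>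
  have I: "(\<integral>x. sph_harm l m x * cnj (sph_harm l' m' x) \<partial>sphere_measure)
      = (if m - m' = 0 then 2 * pi * (\<integral>\<theta>. indicator {0..pi} \<theta> *\<^sub>R (sin \<theta> * g \<theta>) \<partial>lborel) else 0)"
  proof (rule integral_sphere_separated)
    show "continuous_on S2 (\<lambda>x. sph_harm l m x * cnj (sph_harm l' m' x))"
      by (intro continuous_intros continuous_on_sph_harm)
    show "continuous_on {0..pi} g"
      unfolding g_def by (intro continuous_intros)
    fix \<theta> \<phi> :: real
    have "cis (of_int m * \<phi>) * cnj (cis (of_int m' * \<phi>)) = cis (of_int (m - m') * \<phi>)"
      by (simp add: cis_cnj cis_mult algebra_simps)
    note c = this
    show "sph_harm l m (sphere_point (\<theta>, \<phi>)) * cnj (sph_harm l' m' (sphere_point (\<theta>, \<phi>)))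
        = of_real (g \<theta>) * cis (of_int (m - m') * \<phi>)"
      unfolding sph_harm_sphere_point[OF m] sph_harm_sphere_point[OF m'] g_def c[symmetric]
      by (simp only: complex_cnj_complex_of_real of_real_mult power_add complex_cnj_mult mult_ac)
  qed
  show ?thesis
  proof (cases "m = m'")
    case True
    have s: "?s m * ?s m' = 1"
      using True by (simp add: power_mult_distrib[symmetric])
    have "g \<theta> = harmonic_const l ?a * harmonic_const l' ?a
        * poly ([:1, 0, -1:] ^ ?a * ?D m l * ?D m l') (cos \<theta>)" for \<theta>
    proof -
      have "sin \<theta> ^ (?a + ?a') = poly ([:1, 0, -1:] ^ ?a) (cos \<theta>)"
        using True by (simp add: poly_power power_add power_mult_distrib[symmetric]
            sin_squared_eq[unfolded power2_eq_square] algebra_simps)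
      then show ?thesis
        unfolding g_def s using True by (simp add: mult_ac)
    qed
    then have "(\<integral>\<theta>. indicator {0..pi} \<theta> *\<^sub>R (sin \<theta> * g \<theta>) \<partial>lborel)
       = (harmonic_const l ?a * harmonic_const l' ?a) * legendre_pairing ?a l l'"
      unfolding legendre_pairing_def polar_integral_smult[symmetric]
      by (simp add: polar_integral_def)
    also have "\<dots> = (if l = l' then 1 / (2 * pi) else 0)"
    proof (cases "l = l'")
      case True
      have "?a \<le> l" using m by simp
      have "harmonic_const l ?a * harmonic_const l ?a = (2 * real l + 1) / (4 * pi) * (fact (l - ?a) / fact (l + ?a))"
        by (simp add: harmonic_const_def)
      then show ?thesis
        using True legendre_pairing_self[OF \<open>?a \<le> l\<close>] by simp
    qed (use m in \<open>simp add: legendre_pairing_orthogonal\<close>)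
    finally show ?thesis
      unfolding I using True by simp
  qed (simp add: I)
qed

text \<open>An inductive predicate gives closure properties by rule induction. Equalities are
  demanded on the sphere only, because products of harmonics reduce to harmonics only there.\<close>

inductive harmonic_span :: "(real ^ 3 \<Rightarrow> complex) \<Rightarrow> bool" where
  base: "\<bar>m\<bar> \<le> int l \<Longrightarrow> (\<And>x. x \<in> S2 \<Longrightarrow> f x = c * sph_harm l m x) \<Longrightarrow> harmonic_span f"
| add: "harmonic_span f \<Longrightarrow> harmonic_span g \<Longrightarrow> (\<And>x. x \<in> S2 \<Longrightarrow> h x = f x + g x) \<Longrightarrow> harmonic_span h"

lemma harmonic_span_cong:
  assumes "harmonic_span f" "\<And>x. x \<in> S2 \<Longrightarrow> g x = f x"
  shows "harmonic_span g"
  using assms by (cases rule: harmonic_span.cases) (auto intro: harmonic_span.intros)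

lemma harmonic_span_scale:
  assumes "harmonic_span f"
  shows "harmonic_span (\<lambda>x. c * f x)"
  using assms
proof induction
  case (base m l f d)
  then show ?case
    by (intro harmonic_span.base[of m l _ "c * d"]) (auto simp: mult.assoc)
next
  case (add f g h)
  show ?case
    by (rule harmonic_span.add[OF add.IH]) (simp add: add.hyps distrib_left)
qed

lemma cnj_sph_harm: "cnj (sph_harm l m x) = (-1) ^ nat \<bar>m\<bar> * sph_harm l (- m) x"
proof -
  have 0: "cnj (sph_harm_nonneg l 0 x) = sph_harm_nonneg l 0 x"
    by (simp add: sph_harm_nonneg_def)
  have 1: "(-1) ^ n * ((-1) ^ n * z) = z" for n and z :: complex
    by (simp add: mult.assoc[symmetric] power_mult_distrib[symmetric])
  show ?thesis
    using 0 1 by (cases m "0 :: int" rule: linorder_cases) (auto simp: sph_harm_def)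
qed

lemma harmonic_span_cnj:
  assumes "harmonic_span f"
  shows "harmonic_span (\<lambda>x. cnj (f x))"
  using assms
proof induction
  case (base m l f d)
  then show ?case
    by (intro harmonic_span.base[of "- m" l _ "cnj d * (-1) ^ nat \<bar>m\<bar>"]) (auto simp: cnj_sph_harm)
next
  case (add f g h)
  show ?case
    by (rule harmonic_span.add[OF add.IH]) (simp add: add.hyps)
qed

text \<open>In polar coordinates this is sin^|m| \<theta> exp (i m \<phi>). Up to polynomial factors
  in x3 these functions multiply by adding their indices, which the harmonics themselves do
  not.\<close>

definition azimuthal :: "int \<Rightarrow> real ^ 3 \<Rightarrow> complex" where
  "azimuthal m x = (if 0 \<le> m then Complex (x $ 1) (x $ 2) ^ nat m else cnj (Complex (x $ 1) (x $ 2)) ^ nat (- m))"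

text \<open>For fixed m, the m-th derivatives of the Legendre polynomials of degrees m, m + 1, ...
  have degrees exactly 0, 1, ... and hence span all polynomials. The induction removes the leading
  term of q with the derivative of matching degree.\<close>

lemma harmonic_span_power:
  "harmonic_span (\<lambda>x. of_real (poly q (x $ 3)) * Complex (x $ 1) (x $ 2) ^ m)"
proof -
  \<comment> \<open>The zero polynomial has \<open>degree\<close> 0 and must be listed separately
    for the induction to start at n = 0.\<close>
  have "harmonic_span (\<lambda>x. of_real (poly q (x $ 3)) * Complex (x $ 1) (x $ 2) ^ m)"
    if "q = 0 \<or> degree q < n" for n
    using that
  proof (induction n arbitrary: q)
    case 0
    have "harmonic_span (\<lambda>x. 0 * sph_harm 0 0 x)"
      by (rule harmonic_span.base[of 0 0]) auto
    then show ?case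
      using 0 by simp
  next
    case (Suc n)
    define p where "p = (pderiv ^^ m) (legendre_poly (m + n))"
    have p: "degree p = n"
      by (simp add: p_def degree_higher_pderiv degree_legendre_poly)
    have "p \<noteq> 0"
    proof
      assume "p = 0"
      then have "(pderiv ^^ n) p = 0"
        by simp
      moreover have "(pderiv ^^ n) p = (pderiv ^^ (m + n)) (legendre_poly (m + n))"
        unfolding p_def by (metis add.commute comp_apply funpow_add)
      ultimately show False
        unfolding higher_pderiv_legendre_poly_self by simp
    qed
    then have lc: "coeff p n \<noteq> 0"
      using p by auto
    \<comment> \<open>Chosen so that the coefficients of order n cancel in q - c p.\<close>
    define c where "c = coeff q n / coeff p n"
    define q' where "q' = q - smult c p"
    have "coeff q' n = 0"
      using lc by (simp add: q'_def c_def)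
    moreover have "degree q' \<le> n"
      unfolding q'_def using Suc.prems p by (intro degree_diff_le) (auto intro: order_trans[OF degree_smult_le])
    ultimately have "q' = 0 \<or> degree q' < n"
      by (metis leading_coeff_0_iff le_neq_implies_less)
    from Suc.IH[OF this] have 1: "harmonic_span (\<lambda>x. of_real (poly q' (x $ 3)) * Complex (x $ 1) (x $ 2) ^ m)" .
    define k where "k = harmonic_const (m + n) m * (-1) ^ m"
    have "k \<noteq> 0"
      using harmonic_const_pos[of "m + n" m] by (simp add: k_def)
    have 2: "harmonic_span (\<lambda>x. of_real (c / k) * sph_harm (m + n) (int m) x)"
      by (rule harmonic_span.base[of "int m" "m + n" _ "of_real (c / k)"]) auto
    show ?case
    proof (rule harmonic_span.add[OF 1 2])
      fix x :: "real ^ 3" assume "x \<in> S2"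
      then have "sph_harm (m + n) (int m) x = of_real (k * poly p (x $ 3)) * Complex (x $ 1) (x $ 2) ^ m"
        by (simp add: sph_harm_def sph_harm_nonneg_eq k_def p_def)
      moreover have "poly q (x $ 3) = poly q' (x $ 3) + c / k * (k * poly p (x $ 3))"
        using \<open>k \<noteq> 0\<close> by (simp add: q'_def)
      ultimately show "of_real (poly q (x $ 3)) * Complex (x $ 1) (x $ 2) ^ m
          = of_real (poly q' (x $ 3)) * Complex (x $ 1) (x $ 2) ^ m
            + of_real (c / k) * sph_harm (m + n) (int m) x"
        by (simp only: of_real_add of_real_mult distrib_right mult.assoc)
    qed
  qed
  then show ?thesis
    by blast
qed

lemma harmonic_span_azimuthal: "harmonic_span (\<lambda>x. of_real (poly q (x $ 3)) * azimuthal m x)"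
proof (cases "0 \<le> m")
  case True
  then show ?thesis
    using harmonic_span_power[of q "nat m"] by (simp add: azimuthal_def)
next
  case False
  then show ?thesis
    using harmonic_span_cnj[OF harmonic_span_power[of q "nat (- m)"]] by (simp add: azimuthal_def)
qed

text \<open>For indices of opposite sign, the common powers of z and its conjugate pair up to powers
  of 1 - x3^2 on the sphere, which form the factor u.\<close>

lemma azimuthal_mult:
  "\<exists>u. \<forall>x\<in>S2. azimuthal m x * azimuthal n x = of_real (poly u (x $ 3)) * azimuthal (m + n) x"
proof -
  let ?z = "\<lambda>x. Complex (x $ 1) (x $ 2)"
  have norm: "?z x * cnj (?z x) = of_real (poly [:1, 0, -1:] (x $ 3))" if "x \<in> S2" for x
  proof -
    have "(x $ 1)\<^sup>2 + (x $ 2)\<^sup>2 = poly [:1, 0, -1:] (x $ 3)"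
      using that by (simp add: S2_iff power2_eq_square algebra_simps)
    then show ?thesis
      by (simp only: complex_mult_cnj complex.sel)
  qed
  have opposite: "?z x ^ (a + k) * cnj (?z x) ^ k = of_real (poly ([:1, 0, -1:] ^ k) (x $ 3)) * ?z x ^ a"
    "?z x ^ k * cnj (?z x) ^ (a + k) = of_real (poly ([:1, 0, -1:] ^ k) (x $ 3)) * cnj (?z x) ^ a"
    if "x \<in> S2" for x a k
    unfolding poly_power of_real_power norm[OF that, symmetric] power_add power_mult_distrib
    by (simp_all only: mult_ac)
  have *: "\<exists>u. \<forall>x\<in>S2. azimuthal m x * azimuthal n x = of_real (poly u (x $ 3)) * azimuthal (m + n) x"
    if "n < 0" "0 \<le> m" for m n
  proof (cases "0 \<le> m + n")
    case True
    then have "nat m = nat (m + n) + nat (- n)"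
      using that by simp
    then show ?thesis
      using True that opposite(1)[of _ "nat (m + n)" "nat (- n)"]
      by (intro exI[of _ "[:1, 0, -1:] ^ nat (- n)"]) (simp add: azimuthal_def)
  next
    case False
    then have "nat (- n) = nat (- (m + n)) + nat m"
      using that by simp
    then show ?thesis
      using False that opposite(2)[of _ "nat m" "nat (- (m + n))"]
      by (intro exI[of _ "[:1, 0, -1:] ^ nat m"]) (simp add: azimuthal_def)
  qed
  consider "0 \<le> m" "0 \<le> n" | "m < 0" "n < 0" | "n < 0" "0 \<le> m" | "m < 0" "0 \<le> n"
    by linarith
  then show ?thesis
  proof cases
    case 1
    then show ?thesis
      by (intro exI[of _ 1]) (simp add: azimuthal_def nat_add_distrib power_add)
  next
    case 2
    then have "nat (- (m + n)) = nat (- m) + nat (- n)"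
      by simp
    then show ?thesis
      using 2 by (intro exI[of _ 1]) (simp add: azimuthal_def power_add)
  next
    case 3
    then show ?thesis by (rule *)
  next
    case 4
    then show ?thesis
      using *[of m n] by (simp add: mult.commute add.commute)
  qed
qed

lemma sph_harm_azimuthal: "\<exists>q. \<forall>x\<in>S2. sph_harm l m x = of_real (poly q (x $ 3)) * azimuthal m x"
proof -
  define q where "q m = smult (harmonic_const l m * (-1) ^ m) ((pderiv ^^ m) (legendre_poly l))" for m
  show ?thesis
  proof (cases "0 \<le> m")
    case True
    then show ?thesis
      by (intro exI[of _ "q (nat m)"]) (simp add: sph_harm_def azimuthal_def sph_harm_nonneg_eq q_def)
  next
    case False
    then show ?thesis
      by (intro exI[of _ "smult ((-1) ^ nat (- m)) (q (nat (- m)))"])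
        (simp add: sph_harm_def azimuthal_def sph_harm_nonneg_eq q_def)
  qed
qed

text \<open>By bilinearity only two single harmonics have to be multiplied. Each is a polynomial in
  x3 times an azimuthal factor, and the product has the same shape.\<close>

lemma harmonic_span_mult:
  assumes "harmonic_span f" "harmonic_span g"
  shows "harmonic_span (\<lambda>x. f x * g x)"
  using assms(1)
proof induction
  case (base m l f c)
  show ?case
    using assms(2)
  proof induction
    case (base m' l' g d)
    obtain p where p: "\<And>x. x \<in> S2 \<Longrightarrow> sph_harm l m x = of_real (poly p (x $ 3)) * azimuthal m x"
      using sph_harm_azimuthal by blast
    obtain q where q: "\<And>x. x \<in> S2 \<Longrightarrow> sph_harm l' m' x = of_real (poly q (x $ 3)) * azimuthal m' x"
      using sph_harm_azimuthal by blast
    obtain u where u: "\<And>x. x \<in> S2 \<Longrightarrow> azimuthal m x * azimuthal m' x = of_real (poly u (x $ 3)) * azimuthal (m + m') x"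
      using azimuthal_mult by blast
    have "harmonic_span (\<lambda>x. c * d * (of_real (poly (p * q * u) (x $ 3)) * azimuthal (m + m') x))"
      by (intro harmonic_span_scale harmonic_span_azimuthal)
    then show ?case
    proof (rule harmonic_span_cong)
      fix x :: "real ^ 3" assume x: "x \<in> S2"
      have "f x * g x = c * d * (of_real (poly p (x $ 3)) * of_real (poly q (x $ 3)) *
          (azimuthal m x * azimuthal m' x))"
        using x by (simp add: \<open>\<And>x. x \<in> S2 \<Longrightarrow> f x = c * sph_harm l m x\<close> base.hyps p q)
      then show "f x * g x = c * d * (of_real (poly (p * q * u) (x $ 3)) * azimuthal (m + m') x)"
        using x by (simp add: u mult.assoc)
    qed
  next
    case (add g1 g2 g)
    show ?case
      by (rule harmonic_span.add[OF add.IH]) (simp add: add.hyps distrib_left)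
  qed
next
  case (add f1 f2 f)
  show ?case
    by (rule harmonic_span.add[OF add.IH]) (simp add: add.hyps distrib_right)
qed

text \<open>Only linear functions need an argument of their own, since the span contains constants
  and is closed under sums and products.\<close>

lemma harmonic_span_real_polynomial:
  assumes "real_polynomial_function p"
  shows "harmonic_span (\<lambda>x. of_real (p x))"
  using assms
proof induction
  case (linear f)
  interpret bounded_linear f by fact
  have f: "f x = x $ 1 * f (axis 1 1) + x $ 2 * f (axis 2 1) + x $ 3 * f (axis 3 1)" for x
  proof -
    have "x = x $ 1 *\<^sub>R axis 1 1 + x $ 2 *\<^sub>R axis 2 1 + x $ 3 *\<^sub>R axis 3 1"
      by (simp add: vec_eq_iff forall_3 axis_def)
    then have "f x = f (x $ 1 *\<^sub>R axis 1 1 + x $ 2 *\<^sub>R axis 2 1 + x $ 3 *\<^sub>R axis 3 1)"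
      by simp
    then show ?thesis
      by (simp add: add scaleR)
  qed
  let ?c1 = "complex_of_real (f (axis 1 1))" and ?c2 = "complex_of_real (f (axis 2 1))"
  \<comment> \<open>These coefficients solve c1 x1 + c2 x2 = A z + B cnj z with z = x1 + i
    x2.\<close>
  have "harmonic_span (\<lambda>x. ((?c1 - \<i> * ?c2) / 2) * (of_real (poly 1 (x $ 3)) * azimuthal 1 x))"
    "harmonic_span (\<lambda>x. ((?c1 + \<i> * ?c2) / 2) * (of_real (poly 1 (x $ 3)) * azimuthal (- 1) x))"
    "harmonic_span (\<lambda>x. of_real (poly [:0, f (axis 3 1):] (x $ 3)) * azimuthal 0 x)"
    by (intro harmonic_span_scale harmonic_span_azimuthal)+
  note h = harmonic_span.add[OF harmonic_span.add[OF this(1,2) refl] this(3)]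
  have "(c1 - \<i> * c2) / 2 * (a + \<i> * b) + (c1 + \<i> * c2) / 2 * (a - \<i> * b) = a * c1 + b * c2" for a b c1 c2
    by (simp add: field_simps)
  note * = this
  have z: "azimuthal 1 x = of_real (x $ 1) + \<i> * of_real (x $ 2)"
    "azimuthal (- 1) x = of_real (x $ 1) - \<i> * of_real (x $ 2)" "azimuthal 0 x = 1" for x
    by (simp_all add: azimuthal_def complex_eq_iff)
  have "of_real (f x) = of_real (x $ 1) * ?c1 + of_real (x $ 2) * ?c2 + of_real (x $ 3) * complex_of_real (f (axis 3 1))"
    for x by (subst f) simp
  then have fx: "of_real (f x) = (?c1 - \<i> * ?c2) / 2 * (of_real (x $ 1) + \<i> * of_real (x $ 2))
      + (?c1 + \<i> * ?c2) / 2 * (of_real (x $ 1) - \<i> * of_real (x $ 2))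
      + of_real (x $ 3) * complex_of_real (f (axis 3 1))" for x
    unfolding * .
  have p: "of_real (poly 1 t) = (1 :: complex)" "poly [:0, d:] t = t * d" for t d :: real
    by simp_all
  show ?case
    by (rule h, subst fx) (simp only: z p mult_1 mult_1_right of_real_mult)
next
  case (const c)
  show ?case
    using harmonic_span_azimuthal[of "[:c:]" 0] by (simp add: azimuthal_def)
next
  case (add f g)
  show ?case
    by (rule harmonic_span.add[OF add.IH]) simp
next
  case (mult f g)
  show ?case
    using harmonic_span_mult[OF mult.IH] by simp
qed

lemma harmonic_span_partial_synthesis:
  assumes "harmonic_span f"
  shows "\<exists>a L. \<forall>x\<in>S2. f x = partial_synthesis a L x"
proof -
  \<comment> \<open>Strengthened to all later truncations, so that two summands can be synthesised
    at a common degree.\<close>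
  have "\<exists>a L. \<forall>L'\<ge>L. \<forall>x\<in>S2. f x = partial_synthesis a L' x"
    using assms
  proof induction
    case (base m l f c)
    define a where "a = (\<lambda>i. if i = (l, m) then c else 0)"
    have "f x = partial_synthesis a L x" if "l \<le> L" "x \<in> S2" for L x
    proof -
      have "partial_synthesis a L x = (\<Sum>l'\<le>L. \<Sum>m'=-int l'..int l'. if l' = l then if m' = m then c * sph_harm l m x else 0 else 0)"
        unfolding partial_synthesis_def by (intro sum.cong) (auto simp: a_def)
      also have "\<dots> = (\<Sum>l'\<le>L. if l' = l then \<Sum>m'=-int l'..int l'. if m' = m then c * sph_harm l m x else 0 else 0)"
        by (intro sum.cong) auto
      also have "\<dots> = c * sph_harm l m x"
        using that base.hyps by auto
      finally show ?thesis
        using that base.hyps by simp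
    qed
    then show ?case by blast
  next
    case (add f g h)
    then obtain a b L L' where
      fg: "\<And>K x. L \<le> K \<Longrightarrow> x \<in> S2 \<Longrightarrow> f x = partial_synthesis a K x"
      "\<And>K x. L' \<le> K \<Longrightarrow> x \<in> S2 \<Longrightarrow> g x = partial_synthesis b K x"
      by metis
    have "partial_synthesis (\<lambda>i. a i + b i) K x = partial_synthesis a K x + partial_synthesis b K x" for K x
      by (simp add: partial_synthesis_def distrib_right sum.distrib)
    then have "h x = partial_synthesis (\<lambda>i. a i + b i) K x" if "max L L' \<le> K" "x \<in> S2" for K x
      using that add.hyps(3)[of x] fg(1)[of K x] fg(2)[of K x] by simp
    then show ?case by blast
  qed
  then show ?thesis by blast
qed

section \<open>Completeness\<close>

definition sq_integral :: "(real ^ 3 \<Rightarrow> 'b::real_normed_vector) \<Rightarrow> ennreal" where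
  "sq_integral f = (\<integral>\<^sup>+x. ennreal ((norm (f x))\<^sup>2) \<partial>sphere_measure)"

lemma sq_integral_cong: "(\<And>x. x \<in> S2 \<Longrightarrow> f x = g x) \<Longrightarrow> sq_integral f = sq_integral g"
  unfolding sq_integral_def by (rule nn_integral_cong) simp

lemma sq_integral_mono:
  "(\<And>x. x \<in> S2 \<Longrightarrow> norm (f x) \<le> norm (g x)) \<Longrightarrow> sq_integral f \<le> sq_integral g"
  unfolding sq_integral_def by (rule nn_integral_mono) (simp add: power_mono)

lemma norm_add_sq_le: "(norm (a + b))\<^sup>2 \<le> 2 * (norm a)\<^sup>2 + 2 * (norm b)\<^sup>2"
proof -
  have "(norm (a + b))\<^sup>2 \<le> (norm a + norm b)\<^sup>2"
    by (intro power_mono norm_triangle_ineq) auto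
  also have "\<dots> \<le> 2 * (norm a)\<^sup>2 + 2 * (norm b)\<^sup>2"
    using zero_le_power2[of "norm a - norm b"] by (simp add: power2_eq_square algebra_simps)
  finally show ?thesis .
qed

text \<open>A substitute for the triangle inequality that stays with squares and also covers
  infinite values; the factor 2 is harmless in density arguments.\<close>

lemma sq_integral_add_le:
  fixes f g :: "real ^ 3 \<Rightarrow> 'b::{second_countable_topology, real_normed_vector}"
  assumes [measurable]: "f \<in> borel_measurable sphere_measure" "g \<in> borel_measurable sphere_measure"
  shows "sq_integral (\<lambda>x. f x + g x) \<le> 2 * sq_integral f + 2 * sq_integral g"
proof -
  have "sq_integral (\<lambda>x. f x + g x) \<le> (\<integral>\<^sup>+x. 2 * ennreal ((norm (f x))\<^sup>2) + 2 * ennreal ((norm (g x))\<^sup>2) \<partial>sphere_measure)"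
    unfolding sq_integral_def
  proof (rule nn_integral_mono)
    fix x
    have "ennreal ((norm (f x + g x))\<^sup>2) \<le> ennreal (2 * (norm (f x))\<^sup>2 + 2 * (norm (g x))\<^sup>2)"
      by (intro ennreal_leI norm_add_sq_le)
    then show "ennreal ((norm (f x + g x))\<^sup>2) \<le> 2 * ennreal ((norm (f x))\<^sup>2) + 2 * ennreal ((norm (g x))\<^sup>2)"
      by (simp add: ennreal_plus ennreal_mult)
  qed
  then show ?thesis
    by (simp add: sq_integral_def nn_integral_add nn_integral_cmult)
qed

lemma sq_integral_scaleR:
  fixes f :: "real ^ 3 \<Rightarrow> 'b::{second_countable_topology, real_normed_vector}"
  assumes [measurable]: "f \<in> borel_measurable sphere_measure"
  shows "sq_integral (\<lambda>x. c *\<^sub>R f x) = ennreal (c\<^sup>2) * sq_integral f"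
  unfolding sq_integral_def
  by (subst nn_integral_cmult[symmetric]) (auto simp: power_mult_distrib ennreal_mult)

text \<open>Membership in the closure of the polynomials in real L2 of the sphere; e bounds the
  squared distance.\<close>

definition polynomially_approximable :: "(real ^ 3 \<Rightarrow> real) \<Rightarrow> bool" where
  "polynomially_approximable t \<longleftrightarrow> t \<in> borel_measurable sphere_measure \<and>
     (\<forall>e>0. \<exists>p. real_polynomial_function p \<and> sq_integral (\<lambda>x. t x - p x) < ennreal e)"

lemma borel_measurable_real_polynomial:
  "real_polynomial_function p \<Longrightarrow> p \<in> borel_measurable sphere_measure"
  by (intro borel_measurable_sphere_cont continuous_on_polymonial_function)
    (simp add: real_polynomial_function_eq[symmetric])

lemma approximable_cong:
  assumes "polynomially_approximable t" "\<And>x. x \<in> S2 \<Longrightarrow> s x = t x"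
  shows "polynomially_approximable s"
proof -
  have "s \<in> borel_measurable sphere_measure \<longleftrightarrow> t \<in> borel_measurable sphere_measure"
    by (rule measurable_cong) (simp add: assms(2))
  moreover have "sq_integral (\<lambda>x. s x - p x) = sq_integral (\<lambda>x. t x - p x)" for p
    by (rule sq_integral_cong) (simp add: assms(2))
  ultimately show ?thesis
    using assms(1) by (simp add: polynomially_approximable_def)
qed

lemma approximable_by_approximable:
  assumes [measurable]: "t \<in> borel_measurable sphere_measure"
    and *: "\<And>e. 0 < e \<Longrightarrow> \<exists>s. polynomially_approximable s \<and> sq_integral (\<lambda>x. t x - s x) < ennreal e"
  shows "polynomially_approximable t"
  unfolding polynomially_approximable_def
proof (intro conjI allI impI)
  fix e :: real assume "0 < e"
  \<comment> \<open>Two errors of e / 4, each doubled by \<open>sq_integral_add_le\<close>, add up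
    to e.\<close>
  then have e: "0 < e / 4" by simp
  obtain s where s: "polynomially_approximable s" "sq_integral (\<lambda>x. t x - s x) < ennreal (e / 4)"
    using *[OF e] by blast
  then obtain p where p: "real_polynomial_function p" "sq_integral (\<lambda>x. s x - p x) < ennreal (e / 4)"
    using e unfolding polynomially_approximable_def by blast
  have [measurable]: "s \<in> borel_measurable sphere_measure" "p \<in> borel_measurable sphere_measure"
    using s(1) borel_measurable_real_polynomial[OF p(1)] by (auto simp: polynomially_approximable_def)
  have "sq_integral (\<lambda>x. t x - p x) = sq_integral (\<lambda>x. (t x - s x) + (s x - p x))"
    by simp
  also have "\<dots> \<le> 2 * sq_integral (\<lambda>x. t x - s x) + 2 * sq_integral (\<lambda>x. s x - p x)"
    by (rule sq_integral_add_le) measurable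
  also have "\<dots> < 2 * ennreal (e / 4) + 2 * ennreal (e / 4)"
    using s(2) p(2) by (intro add_strict_mono ennreal_mult_strict_left_mono) auto
  also have "\<dots> = ennreal e"
    using \<open>0 < e\<close> by (simp add: ennreal_plus[symmetric] ennreal_mult'[symmetric]
        ennreal_numeral[symmetric] del: ennreal_plus ennreal_numeral)
  finally show "\<exists>p. real_polynomial_function p \<and> sq_integral (\<lambda>x. t x - p x) < ennreal e"
    using p(1) by blast
qed simp

text \<open>Pointwise limits are handled by dominated convergence; it is the error, not the
  sequence, that is dominated by a square-integrable function.\<close>

lemma approximable_limit:
  assumes [measurable]: "t \<in> borel_measurable sphere_measure" "w \<in> borel_measurable sphere_measure"
    and s: "\<And>i :: nat. polynomially_approximable (s i)"
    and w: "sq_integral w < \<infinity>" "\<And>i x. x \<in> S2 \<Longrightarrow> \<bar>t x - s i x\<bar> \<le> \<bar>w x :: real\<bar>"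
    and lim: "\<And>x. x \<in> S2 \<Longrightarrow> (\<lambda>i. s i x) \<longlonglongrightarrow> t x"
  shows "polynomially_approximable t"
proof (rule approximable_by_approximable)
  fix e :: real assume e: "0 < e"
  have [measurable]: "\<And>i. s i \<in> borel_measurable sphere_measure"
    using s by (auto simp: polynomially_approximable_def)
  have "(\<lambda>i. \<integral>\<^sup>+x. ennreal ((t x - s i x)\<^sup>2) \<partial>sphere_measure) \<longlonglongrightarrow> (\<integral>\<^sup>+x. 0 \<partial>sphere_measure)"
  proof (rule nn_integral_dominated_convergence)
    show "(\<integral>\<^sup>+x. ennreal ((w x)\<^sup>2) \<partial>sphere_measure) < \<infinity>"
      using w(1) by (simp add: sq_integral_def)
    show "AE x in sphere_measure. ennreal ((t x - s i x)\<^sup>2) \<le> ennreal ((w x)\<^sup>2)" for i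
      by (intro AE_I2 ennreal_leI) (simp add: w(2) abs_le_square_iff[symmetric])
    show "AE x in sphere_measure. (\<lambda>i. ennreal ((t x - s i x)\<^sup>2)) \<longlonglongrightarrow> 0"
    proof (rule AE_I2)
      fix x assume "x \<in> space sphere_measure"
      then have "(\<lambda>i. ennreal ((t x - s i x)\<^sup>2)) \<longlonglongrightarrow> ennreal ((t x - t x)\<^sup>2)"
        by (intro tendsto_ennrealI tendsto_intros lim) simp
      then show "(\<lambda>i. ennreal ((t x - s i x)\<^sup>2)) \<longlonglongrightarrow> 0"
        by simp
    qed
  qed measurable
  then have "(\<lambda>i. sq_integral (\<lambda>x. t x - s i x)) \<longlonglongrightarrow> 0"
    by (simp add: sq_integral_def)
  from order_tendstoD(2)[OF this, of "ennreal e"] e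
  obtain i where "sq_integral (\<lambda>x. t x - s i x) < ennreal e"
    by (auto simp: eventually_sequentially)
  then show "\<exists>s. polynomially_approximable s \<and> sq_integral (\<lambda>x. t x - s x) < ennreal e"
    using s by blast
qed simp

lemma approximable_lincomb:
  assumes t: "polynomially_approximable t" and s: "polynomially_approximable s"
  shows "polynomially_approximable (\<lambda>x. a * t x + b * s x)"
  unfolding polynomially_approximable_def
proof (intro conjI allI impI)
  have [measurable]: "t \<in> borel_measurable sphere_measure" "s \<in> borel_measurable sphere_measure"
    using t s by (auto simp: polynomially_approximable_def)
  show "(\<lambda>x. a * t x + b * s x) \<in> borel_measurable sphere_measure"
    by measurable
  fix e :: real assume "0 < e"
  \<comment> \<open>The summand 1 keeps C positive when a = b = 0 and makes the final estimate
    strict.\<close>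
  define C where "C = 2 * a\<^sup>2 + 2 * b\<^sup>2 + 1"
  have C: "0 < C"
    by (simp add: C_def add_nonneg_pos)
  define d where "d = e / C"
  have d: "0 < d" using C \<open>0 < e\<close> by (simp add: d_def)
  then obtain p q where p: "real_polynomial_function p" "sq_integral (\<lambda>x. t x - p x) < ennreal d"
    and q: "real_polynomial_function q" "sq_integral (\<lambda>x. s x - q x) < ennreal d"
    using t s unfolding polynomially_approximable_def by metis
  have [measurable]: "p \<in> borel_measurable sphere_measure" "q \<in> borel_measurable sphere_measure"
    using borel_measurable_real_polynomial p(1) q(1) by auto
  have "sq_integral (\<lambda>x. (a * t x + b * s x) - (a * p x + b * q x))
      = sq_integral (\<lambda>x. a *\<^sub>R (t x - p x) + b *\<^sub>R (s x - q x))"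
    by (rule sq_integral_cong) (simp add: algebra_simps)
  also have "\<dots> \<le> 2 * sq_integral (\<lambda>x. a *\<^sub>R (t x - p x)) + 2 * sq_integral (\<lambda>x. b *\<^sub>R (s x - q x))"
    by (rule sq_integral_add_le) measurable
  also have "\<dots> = 2 * (ennreal (a\<^sup>2) * sq_integral (\<lambda>x. t x - p x)) + 2 * (ennreal (b\<^sup>2) * sq_integral (\<lambda>x. s x - q x))"
    by (subst (1 2) sq_integral_scaleR) auto
  also have "\<dots> \<le> 2 * (ennreal (a\<^sup>2) * ennreal d) + 2 * (ennreal (b\<^sup>2) * ennreal d)"
    using p(2) q(2) by (intro add_mono mult_left_mono) auto
  also have "\<dots> = ennreal ((2 * a\<^sup>2 + 2 * b\<^sup>2) * d)"
    using d by (simp add: ennreal_plus[symmetric] ennreal_mult'[symmetric] algebra_simps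
        ennreal_numeral[symmetric] del: ennreal_plus ennreal_numeral)
  also have "\<dots> < ennreal e"
  proof (rule ennreal_lessI)
    have "(2 * a\<^sup>2 + 2 * b\<^sup>2) * d < C * d"
      using d by (intro mult_strict_right_mono) (simp_all add: C_def)
    then show "(2 * a\<^sup>2 + 2 * b\<^sup>2) * d < e"
      using C by (simp add: d_def)
  qed fact
  finally show "\<exists>p. real_polynomial_function p \<and> sq_integral (\<lambda>x. a * t x + b * s x - p x) < ennreal e"
    using p(1) q(1) by (intro exI[of _ "\<lambda>x. a * p x + b * q x"] conjI real_polynomial_function.intros(2-4))
qed

lemma approximable_continuous:
  assumes "continuous_on S2 t"
  shows "polynomially_approximable t"
  unfolding polynomially_approximable_def
proof (intro conjI allI impI)
  fix e :: real assume e: "0 < e"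
  define C where "C = measure sphere_measure S2"
  \<comment> \<open>A uniform error d costs at most d^2 C in squared distance, where C is the total
    mass; this choice makes d^2 C = e C / (C + 1) < e.\<close>
  define d where "d = sqrt (e / (C + 1))"
  have C: "0 \<le> C" by (simp add: C_def)
  then have d: "0 < d" using e by (simp add: d_def)
  obtain p where p: "real_polynomial_function p" "\<And>x. x \<in> S2 \<Longrightarrow> \<bar>t x - p x\<bar> < d"
    using Stone_Weierstrass_real_polynomial_function[OF compact_S2 assms d] by blast
  have "sq_integral (\<lambda>x. t x - p x) \<le> (\<integral>\<^sup>+x. ennreal (d\<^sup>2) \<partial>sphere_measure)"
    unfolding sq_integral_def
    by (intro nn_integral_mono ennreal_leI) (simp, metis p(2) abs_le_square_iff abs_of_pos d less_imp_le)
  also have "\<dots> = ennreal (d\<^sup>2 * C)"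
    by (simp add: C_def sphere.emeasure_eq_measure ennreal_mult)
  also have "\<dots> < ennreal e"
    using C e by (intro ennreal_lessI) (simp_all add: d_def field_simps)
  finally show "\<exists>p. real_polynomial_function p \<and> sq_integral (\<lambda>x. t x - p x) < ennreal e"
    using p(1) by blast
qed (intro borel_measurable_sphere_cont assms)

lemma sq_integral_const: "sq_integral (\<lambda>_. c) < \<infinity>"
  by (simp add: sq_integral_def sphere.emeasure_eq_measure ennreal_mult_less_top)

lemma borel_measurable_indicator_sphere:
  "B \<in> sets borel \<Longrightarrow> (indicator B :: _ \<Rightarrow> real) \<in> borel_measurable sphere_measure"
  by (simp add: measurable_restrict_space1 cong: measurable_cong_sets add: sets_sphere_measure)

lemma approximable_indicator_closed:
  fixes B :: "(real ^ 3) set"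
  assumes "closed B"
  shows "polynomially_approximable (indicator B)"
proof (cases "B = {}")
  case True
  then show ?thesis
    by (intro approximable_continuous) (simp add: indicator_def)
next
  case False
  \<comment> \<open>Continuous functions that decrease to the indicator of B. The empty set is
    treated apart because \<open>infdist\<close> to it is 0 by convention.\<close>
  define s where "s i x = max 0 (1 - real i * infdist x B)" for i x
  show ?thesis
  proof (rule approximable_limit[where s = s and w = "\<lambda>_. 1"])
    show "polynomially_approximable (s i)" for i
      unfolding s_def by (intro approximable_continuous continuous_intros)
    show "\<bar>indicator B x - s i x\<bar> \<le> \<bar>1\<bar>" for i x
      by (auto simp: s_def indicator_def max_def infdist_nonneg)
    show "(\<lambda>i. s i x) \<longlonglongrightarrow> indicator B x" for x
    proof (cases "x \<in> B")
      case True
      then show ?thesis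
        by (simp add: s_def)
    next
      case x: False
      then have d: "0 < infdist x B"
        using assms False by (simp add: infdist_pos_not_in_closed)
      obtain N :: nat where N: "1 / infdist x B < real N"
        using reals_Archimedean2 by blast
      have "s i x = 0" if "N \<le> i" for i
      proof -
        have "1 < real N * infdist x B"
          using N d by (simp add: field_simps)
        also have "\<dots> \<le> real i * infdist x B"
          using that d by simp
        finally show ?thesis
          by (simp add: s_def)
      qed
      then show ?thesis
        using x by (intro tendsto_eventually) (auto simp: eventually_sequentially)
    qed
  qed (use assms in \<open>auto intro: borel_measurable_indicator_sphere sq_integral_const[unfolded infinity_ennreal_def]\<close>)
qed

text \<open>Dynkin's argument: open sets are stable under intersection, complements follow from
  linearity with the constant 1, and countable disjoint unions are dominated limits of finite
  ones.\<close>

lemma approximable_indicator: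
  fixes B :: "(real ^ 3) set"
  assumes "B \<in> sets borel"
  shows "polynomially_approximable (indicator B)"
proof -
  have 1: "polynomially_approximable (\<lambda>x. 1)"
    by (intro approximable_continuous continuous_intros)
  have compl: "polynomially_approximable (indicator (- A))" if "polynomially_approximable (indicator A)" for A :: "(real ^ 3) set"
    by (rule approximable_cong[OF approximable_lincomb[OF 1 that, of 1 "-1"]]) (simp add: indicator_def)
  have "Int_stable {S :: (real ^ 3) set. open S}"
    by (auto simp: Int_stable_def)
  moreover have "{S :: (real ^ 3) set. open S} \<subseteq> Pow UNIV"
    by simp
  moreover have "B \<in> sigma_sets UNIV {S. open S}"
    using assms by (simp add: borel_def)
  ultimately show ?thesis
  proof (induct rule: sigma_sets_induct_disjoint)
    case (basic A)
    then show ?case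
      using compl[OF approximable_indicator_closed[of "- A"]] by auto
  next
    case empty
    show ?case
      by (rule approximable_indicator_closed) simp
  next
    case (compl A)
    then show ?case
      using \<open>polynomially_approximable (indicator A) \<Longrightarrow> polynomially_approximable (indicator (- A))\<close>
      by (simp add: Compl_eq_Diff_UNIV)
  next
    case (union A)
    have meas: "A i \<in> sets borel" for i
      using union(2) by (auto simp: borel_def)
    have part: "polynomially_approximable (indicator (\<Union>i<n. A i))" for n
    proof (induction n)
      case 0
      show ?case
        using approximable_indicator_closed[of "{}"] by (simp only: lessThan_0 UN_empty closed_empty simp_thms)
    next
      case (Suc n)
      show ?case
      proof (rule approximable_cong[OF approximable_lincomb[OF Suc union(3)[of n], of 1 1]])
        have "(\<Union>i<n. A i) \<inter> A n = {}"
          using union(1) by (auto simp: disjoint_family_on_def) (metis disjoint_iff less_irrefl)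
        moreover have "(\<Union>i<Suc n. A i) = (\<Union>i<n. A i) \<union> A n"
          by (auto simp: less_Suc_eq)
        ultimately show "indicator (\<Union>i<Suc n. A i) x = 1 * indicator (\<Union>i<n. A i) x + 1 * (indicator (A n) x :: real)" for x
          by (simp add: indicator_add)
      qed
    qed
    show ?case
    proof (rule approximable_limit[where s = "\<lambda>n. indicator (\<Union>i<n. A i)" and w = "\<lambda>_. 1"])
      show "\<bar>indicator (\<Union>i. A i) x - indicator (\<Union>i<n. A i) x\<bar> \<le> \<bar>1 :: real\<bar>" for n x
        by (simp add: indicator_def)
      show "(\<lambda>n. indicator (\<Union>i<n. A i) x :: real) \<longlonglongrightarrow> indicator (\<Union>i. A i) x" for x
        by (rule LIMSEQ_indicator_UN)
    qed (use part meas in \<open>auto intro!: borel_measurable_indicator_sphere sq_integral_const[unfolded infinity_ennreal_def]\<close>)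
  qed
qed

lemma approximable_nonneg:
  assumes "t \<in> borel_measurable sphere_measure" "\<And>x. 0 \<le> t x" "sq_integral t < \<infinity>"
  shows "polynomially_approximable t"
  using assms
proof (induction rule: borel_measurable_induct_real)
  case (set A)
  then obtain B where B: "B \<in> sets borel" "A = S2 \<inter> B"
    by (auto simp: sets_sphere_measure sets_restrict_space)
  show ?case
    by (rule approximable_cong[OF approximable_indicator[OF B(1)]]) (simp add: B(2) indicator_def)
next
  case (mult u c)
  show ?case
  \<comment> \<open>For c = 0 square integrability of the product says nothing about u, because 0
    times infinity is 0 in \<open>ennreal\<close>.\<close>
  proof (cases "c = 0")
    case True
    then show ?thesis
      by (intro approximable_continuous) simp
  next
    case False
    have "ennreal (c\<^sup>2) * sq_integral u < \<infinity>"
      using mult sq_integral_scaleR[of u c] by simp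
    then have "sq_integral u < \<infinity>"
      using False by (auto simp: ennreal_mult_less_top top_unique less_top ennreal_mult_eq_top_iff)
    then show ?thesis
      using approximable_lincomb[OF mult(4) mult(4), of c 0] by simp
  qed
next
  case (add u v)
  have "sq_integral u \<le> sq_integral (\<lambda>x. v x + u x)" "sq_integral v \<le> sq_integral (\<lambda>x. v x + u x)"
    using add by (auto intro!: sq_integral_mono)
  then have "sq_integral u < \<infinity>" "sq_integral v < \<infinity>"
    using add.prems by auto
  then show ?case
    using approximable_lincomb[OF add.IH(2) add.IH(1), of 1 1] by simp
next
  case (seq U)
  have le: "U i x \<le> t x" if "x \<in> S2" for i x
    using seq that by (intro incseq_le[of "\<lambda>i. U i x"]) (auto simp: incseq_def le_fun_def)
  have "sq_integral (U i) \<le> sq_integral t" for i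
    using seq(2) order_trans[OF le abs_ge_self] by (intro sq_integral_mono) simp
  then have "polynomially_approximable (U i)" for i
    using seq by (meson le_less_trans)
  moreover have "\<bar>t x - U i x\<bar> \<le> \<bar>t x\<bar>" if "x \<in> S2" for i x
    using le[OF that, of i] seq(2)[of i x] by simp
  ultimately show ?case
    using seq.prems seq.hyps(4)
    by (intro approximable_limit[OF assms(1) assms(1), where s = U]) (simp_all add: assms(3))
qed

lemma approximable_sq_integrable:
  assumes [measurable]: "t \<in> borel_measurable sphere_measure" and "sq_integral t < \<infinity>"
  shows "polynomially_approximable t"
proof -
  have "sq_integral (\<lambda>x. max 0 (t x)) \<le> sq_integral t" "sq_integral (\<lambda>x. max 0 (- t x)) \<le> sq_integral t"
    by (auto intro!: sq_integral_mono)
  then have "polynomially_approximable (\<lambda>x. max 0 (t x))" "polynomially_approximable (\<lambda>x. max 0 (- t x))"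
    using assms(2) by (auto intro!: approximable_nonneg)
  from approximable_lincomb[OF this, of 1 "-1"] show ?thesis
    by (rule approximable_cong) auto
qed

section \<open>Residuals in the harmonic basis\<close>

text \<open>A real number, so that differences and real limits are available. It is 0 when the
  integral is infinite, hence the finiteness hypotheses wherever it is used as a norm.\<close>

definition sphere_l2 :: "(real ^ 3 \<Rightarrow> complex) \<Rightarrow> real" where
  "sphere_l2 f = sqrt (enn2real (sq_integral f))"

lemma sphere_l2_nonneg [simp]: "0 \<le> sphere_l2 f"
  by (simp add: sphere_l2_def)

lemma sphere_l2_power2: "sq_integral f < \<infinity> \<Longrightarrow> ennreal ((sphere_l2 f)\<^sup>2) = sq_integral f"
  by (simp add: sphere_l2_def)

lemma L2norm_eq: "L2norm f = (if sq_integral f = \<infinity> then \<infinity> else ennreal (sphere_l2 f))"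
  by (simp add: L2norm_def sq_integral_def sphere_l2_def Let_def)

lemma L2norm_power2: "(L2norm f)\<^sup>2 = sq_integral f"
  by (cases "sq_integral f = \<infinity>") (auto simp: L2norm_eq ennreal_power sphere_l2_power2 less_top)

lemma L2norm_less_top_iff: "L2norm f < \<infinity> \<longleftrightarrow> sq_integral f < \<infinity>"
  by (simp add: L2norm_eq less_top)

lemma sphere_l2_minus_commute: "sphere_l2 (\<lambda>x. f x - g x) = sphere_l2 (\<lambda>x. g x - f x)"
  by (simp add: sphere_l2_def sq_integral_def norm_minus_commute)

lemma sq_integral_add_finite:
  fixes f g :: "real ^ 3 \<Rightarrow> 'b::{second_countable_topology, real_normed_vector}"
  assumes "f \<in> borel_measurable sphere_measure" "g \<in> borel_measurable sphere_measure"
    and "sq_integral f < \<infinity>" "sq_integral g < \<infinity>"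
  shows "sq_integral (\<lambda>x. f x + g x) < \<infinity>"
  by (rule le_less_trans[OF sq_integral_add_le[OF assms(1,2)]])
    (use assms(3,4) in \<open>simp add: ennreal_mult_less_top\<close>)

lemma sq_integral_diff_finite:
  fixes f g :: "real ^ 3 \<Rightarrow> 'b::{second_countable_topology, real_normed_vector}"
  assumes "f \<in> borel_measurable sphere_measure" "g \<in> borel_measurable sphere_measure"
    and "sq_integral f < \<infinity>" "sq_integral g < \<infinity>"
  shows "sq_integral (\<lambda>x. f x - g x) < \<infinity>"
  using sq_integral_add_finite[of f "\<lambda>x. - g x"] assms by (simp add: sq_integral_def)

text \<open>Minkowski's inequality: the cross term in the expanded square is bounded by
  Cauchy-Schwarz.\<close>

lemma sphere_l2_triangle:
  assumes [measurable]: "f \<in> borel_measurable sphere_measure" "g \<in> borel_measurable sphere_measure"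
    and f: "sq_integral f < \<infinity>" and g: "sq_integral g < \<infinity>"
  shows "sphere_l2 (\<lambda>x. f x + g x) \<le> sphere_l2 f + sphere_l2 g"
proof -
  let ?A = "sphere_l2 f" and ?B = "sphere_l2 g"
  define I where "I = (\<integral>\<^sup>+x. ennreal (cmod (f x)) * ennreal (cmod (g x)) \<partial>sphere_measure)"
  have "I\<^sup>2 \<le> sq_integral f * sq_integral g"
    using Cauchy_Schwarz_nn_integral[of "\<lambda>x. ennreal (cmod (f x))" sphere_measure "\<lambda>x. ennreal (cmod (g x))"]
    by (simp add: I_def sq_integral_def ennreal_power)
  also have "\<dots> = (ennreal (?A * ?B))\<^sup>2"
    by (simp add: sphere_l2_power2[OF f, symmetric] sphere_l2_power2[OF g, symmetric] ennreal_power
        power_mult_distrib ennreal_mult)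
  finally have I: "I \<le> ennreal (?A * ?B)"
    by (cases I) (auto simp: ennreal_power top_unique power2_le_iff_abs_le)
  have "sq_integral (\<lambda>x. f x + g x) \<le>
      (\<integral>\<^sup>+x. (ennreal ((cmod (f x))\<^sup>2) + ennreal ((cmod (g x))\<^sup>2)) + 2 * (ennreal (cmod (f x)) * ennreal (cmod (g x))) \<partial>sphere_measure)"
    unfolding sq_integral_def
  proof (rule nn_integral_mono)
    fix x
    have "(cmod (f x + g x))\<^sup>2 \<le> (cmod (f x) + cmod (g x))\<^sup>2"
      by (intro power_mono norm_triangle_ineq) auto
    also have "\<dots> = ((cmod (f x))\<^sup>2 + (cmod (g x))\<^sup>2) + 2 * (cmod (f x) * cmod (g x))"
      by (simp add: power2_sum)
    finally show "ennreal ((cmod (f x + g x))\<^sup>2) \<le>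
        (ennreal ((cmod (f x))\<^sup>2) + ennreal ((cmod (g x))\<^sup>2)) + 2 * (ennreal (cmod (f x)) * ennreal (cmod (g x)))"
      by (simp add: ennreal_leI ennreal_mult[symmetric] ennreal_plus[symmetric] ennreal_numeral[symmetric]
          del: ennreal_plus ennreal_numeral)
  qed
  also have "\<dots> = sq_integral f + sq_integral g + 2 * I"
    by (simp add: sq_integral_def I_def nn_integral_add nn_integral_cmult)
  also have "\<dots> \<le> ennreal (?A\<^sup>2) + ennreal (?B\<^sup>2) + 2 * ennreal (?A * ?B)"
    using I by (intro add_mono mult_left_mono) (simp_all add: sphere_l2_power2[OF f] sphere_l2_power2[OF g])
  also have "\<dots> = ennreal ((?A + ?B)\<^sup>2)"
    by (simp add: power2_sum ennreal_mult[symmetric] ennreal_plus[symmetric] ennreal_numeral[symmetric] mult.assoc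
          del: ennreal_plus ennreal_numeral)
  finally have *: "sq_integral (\<lambda>x. f x + g x) \<le> ennreal ((?A + ?B)\<^sup>2)" .
  then have "sq_integral (\<lambda>x. f x + g x) < \<infinity>"
    by (auto intro: le_less_trans)
  then have "(sphere_l2 (\<lambda>x. f x + g x))\<^sup>2 \<le> (?A + ?B)\<^sup>2"
    using * by (simp add: sphere_l2_power2[symmetric])
  then show ?thesis
    by (rule power2_le_imp_le) simp
qed

text \<open>Two triangle inequalities bound the difference of the norms by the norm of f - s
  L.\<close>

lemma sphere_l2_tendsto:
  assumes [measurable]: "t \<in> borel_measurable sphere_measure" "f \<in> borel_measurable sphere_measure"
      "\<And>L :: nat. s L \<in> borel_measurable sphere_measure"
    and fin: "sq_integral t < \<infinity>" "sq_integral f < \<infinity>" "\<And>L. sq_integral (s L) < \<infinity>"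
    and lim: "(\<lambda>L. sphere_l2 (\<lambda>x. f x - s L x)) \<longlonglongrightarrow> 0"
  shows "(\<lambda>L. sphere_l2 (\<lambda>x. t x - s L x)) \<longlonglongrightarrow> sphere_l2 (\<lambda>x. t x - f x)"
proof (rule LIM_zero_cancel[OF Lim_null_comparison[OF _ lim]])
  have fs: "sq_integral (\<lambda>x. f x - s L x) < \<infinity>" for L
    by (intro sq_integral_diff_finite fin) measurable
  have tf: "sq_integral (\<lambda>x. t x - f x) < \<infinity>"
    by (intro sq_integral_diff_finite fin) measurable
  have ts: "sq_integral (\<lambda>x. t x - s L x) < \<infinity>" for L
    by (intro sq_integral_diff_finite fin) measurable
  have sf: "sq_integral (\<lambda>x. s L x - f x) < \<infinity>" for L
    by (intro sq_integral_diff_finite fin) measurable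
  have 1: "sphere_l2 (\<lambda>x. (t x - f x) + (f x - s L x)) \<le> sphere_l2 (\<lambda>x. t x - f x) + sphere_l2 (\<lambda>x. f x - s L x)" for L
    by (intro sphere_l2_triangle tf fs) measurable
  have 2: "sphere_l2 (\<lambda>x. (t x - s L x) + (s L x - f x)) \<le> sphere_l2 (\<lambda>x. t x - s L x) + sphere_l2 (\<lambda>x. s L x - f x)" for L
    by (intro sphere_l2_triangle ts sf) measurable
  show "\<forall>\<^sub>F L in sequentially. norm (sphere_l2 (\<lambda>x. t x - s L x) - sphere_l2 (\<lambda>x. t x - f x))
      \<le> sphere_l2 (\<lambda>x. f x - s L x)"
    using 1 2 by (intro always_eventually allI) (simp add: sphere_l2_minus_commute[of _ f] abs_le_iff diff_le_eq algebra_simps)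
qed

text \<open>Regroups a double series by degree into an ordinary series, in step with the truncation
  used in \<open>is_L2_sum\<close>.\<close>

definition degree_sum :: "(nat \<times> int \<Rightarrow> 'b::comm_monoid_add) \<Rightarrow> nat \<Rightarrow> 'b" where
  "degree_sum F l = (\<Sum>m = - int l..int l. F (l, m))"

abbreviation coef :: "(real ^ 3 \<Rightarrow> real) \<Rightarrow> nat \<times> int \<Rightarrow> complex" where
  "coef t i \<equiv> harmonic_coef t (fst i) (snd i)"

lemma degree_sum_nonneg: "(\<And>i. 0 \<le> F i) \<Longrightarrow> 0 \<le> (degree_sum F l :: real)"
  by (simp add: degree_sum_def sum_nonneg)

lemma degree_sum_ennreal: "(\<And>i. 0 \<le> F i) \<Longrightarrow> ennreal (degree_sum F l) = degree_sum (\<lambda>i. ennreal (F i)) l"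
  by (simp add: degree_sum_def sum_ennreal)

lemma borel_measurable_sph_harm [measurable]: "sph_harm l m \<in> borel_measurable sphere_measure"
  by (intro borel_measurable_sphere_cont continuous_on_sph_harm)

lemma borel_measurable_partial_synthesis [measurable]:
  "partial_synthesis a L \<in> borel_measurable sphere_measure"
  unfolding partial_synthesis_def by measurable

lemma sq_integral_partial_synthesis: "sq_integral (partial_synthesis a L) < \<infinity>"
proof -
  have "continuous_on S2 (\<lambda>x. (cmod (partial_synthesis a L x))\<^sup>2)"
    unfolding partial_synthesis_def by (intro continuous_intros continuous_on_sph_harm)
  from integrableD(2)[OF integrable_sphere_cont[OF this]] show ?thesis
    by (simp add: sq_integral_def less_top)
qed

text \<open>Expanding the square over a finite orthonormal family and completing the square in each
  coefficient. The array is arbitrary: with the coefficients of t it gives Bessel's inequality, with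
  those of an approximating polynomial it gives completeness.\<close>

lemma sq_integral_residual_partial:
  assumes [measurable]: "t \<in> borel_measurable sphere_measure" and fin: "sq_integral t < \<infinity>"
  shows "(sphere_l2 (\<lambda>x. of_real (t x) - partial_synthesis a L x))\<^sup>2 =
     (\<integral>x. (t x)\<^sup>2 \<partial>sphere_measure) - (\<Sum>l\<le>L. degree_sum (\<lambda>i. (cmod (coef t i))\<^sup>2) l)
       + (\<Sum>l\<le>L. degree_sum (\<lambda>i. (cmod (coef t i - a i))\<^sup>2) l)"
proof -
  define J where "J = (SIGMA l:{..L}. {- int l..int l})"
  define Y where "Y i = sph_harm (fst i) (snd i)" for i
  have [simp]: "finite J"
    by (simp add: J_def)
  have J: "(\<Sum>l\<le>L. degree_sum F l) = (\<Sum>i\<in>J. F i)" for F :: "nat \<times> int \<Rightarrow> real"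
    unfolding J_def degree_sum_def by (subst sum.Sigma) (auto simp: case_prod_beta)
  have S: "partial_synthesis a L x = (\<Sum>i\<in>J. a i * Y i x)" for x
    unfolding J_def partial_synthesis_def Y_def by (subst sum.Sigma) (auto simp: case_prod_beta)
  have contY: "continuous_on S2 (Y i)" for i
    unfolding Y_def by (rule continuous_on_sph_harm)
  have [measurable]: "Y i \<in> borel_measurable sphere_measure"
      "(\<lambda>x. cnj (Y i x)) \<in> borel_measurable sphere_measure" for i
    by (intro borel_measurable_sphere_cont continuous_intros contY)+
  have orth: "(\<integral>x. Y i x * cnj (Y j x) \<partial>sphere_measure) = (if i = j then 1 else 0)" if "i \<in> J" "j \<in> J" for i j
    using that unfolding J_def Y_def
    by (cases i; cases j) (auto simp: sph_harm_orthonormal)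
  have YY: "integrable sphere_measure (\<lambda>x. Y i x * cnj (Y j x))" for i j
    by (intro integrable_sphere_cont continuous_intros contY)
  have tt: "integrable sphere_measure (\<lambda>x. (t x)\<^sup>2)"
    using fin by (intro integrableI_bounded) (simp_all add: sq_integral_def)
  have tY: "integrable sphere_measure (\<lambda>x. of_real (t x) * cnj (Y i x))" for i
  proof (rule Bochner_Integration.integrable_bound)
    show "integrable sphere_measure (\<lambda>x. (t x)\<^sup>2 + (cmod (Y i x))\<^sup>2)"
      by (intro Bochner_Integration.integrable_add tt integrable_sphere_cont continuous_intros contY)
    have "\<bar>u\<bar> * v \<le> u\<^sup>2 + v\<^sup>2" for u v :: real
    proof -
      have "2 * (\<bar>u\<bar> * v) \<le> u\<^sup>2 + v\<^sup>2"
        using zero_le_power2[of "\<bar>u\<bar> - v"] by (simp add: power2_diff mult.assoc)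
      moreover have "0 \<le> u\<^sup>2 + v\<^sup>2"
        by simp
      ultimately show ?thesis by linarith
    qed
    then show "AE x in sphere_measure. norm (of_real (t x) * cnj (Y i x)) \<le> norm ((t x)\<^sup>2 + (cmod (Y i x))\<^sup>2)"
      by (intro AE_I2) (simp add: norm_mult)
  qed measurable
  have c: "(\<integral>x. of_real (t x) * cnj (Y i x) \<partial>sphere_measure) = coef t i" for i
    by (simp add: Y_def harmonic_coef_def)
  have tY': "integrable sphere_measure (\<lambda>x. of_real (t x) * Y i x)" for i
    using integrable_cnj[OF tY[of i]] by simp
  have c': "(\<integral>x. of_real (t x) * Y i x \<partial>sphere_measure) = cnj (coef t i)" for i
    unfolding c[symmetric] Bochner_Integration.integral_cnj[symmetric] by simp
  let ?r = "\<lambda>x. of_real (t x) - partial_synthesis a L x"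
  \<comment> \<open>The computation is done in the complex numbers, where the squared modulus is r
    times its conjugate and expands by linearity.\<close>
  have sq: "complex_of_real ((cmod (?r x))\<^sup>2) = of_real ((t x)\<^sup>2)
      - (\<Sum>i\<in>J. cnj (a i) * (of_real (t x) * cnj (Y i x)))
      - (\<Sum>i\<in>J. a i * (of_real (t x) * Y i x))
      + (\<Sum>i\<in>J. \<Sum>j\<in>J. a i * cnj (a j) * (Y i x * cnj (Y j x)))" for x
  proof -
    define S' where "S' = (\<Sum>i\<in>J. a i * Y i x)"
    have "S' * cnj S' = (\<Sum>i\<in>J. \<Sum>j\<in>J. a i * cnj (a j) * (Y i x * cnj (Y j x)))"
      by (simp add: S'_def cnj_sum sum_product mult_ac)
    moreover have "of_real (t x) * cnj S' = (\<Sum>i\<in>J. cnj (a i) * (of_real (t x) * cnj (Y i x)))"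
      "of_real (t x) * S' = (\<Sum>i\<in>J. a i * (of_real (t x) * Y i x))"
      by (simp_all add: S'_def cnj_sum sum_distrib_left mult_ac)
    moreover have "(of_real (t x) - S') * cnj (of_real (t x) - S')
        = of_real ((t x)\<^sup>2) - of_real (t x) * cnj S' - of_real (t x) * S' + S' * cnj S'"
      by (simp add: algebra_simps power2_eq_square)
    ultimately show ?thesis
      unfolding complex_norm_square S S'_def[symmetric] by simp
  qed
  have "sq_integral ?r < \<infinity>"
    using fin by (intro sq_integral_diff_finite sq_integral_partial_synthesis) (simp_all add: sq_integral_def)
  have fr: "integrable sphere_measure (\<lambda>x. (cmod (?r x))\<^sup>2)"
    using \<open>sq_integral ?r < \<infinity>\<close> by (intro integrableI_bounded) (simp_all add: sq_integral_def)
  have "(sphere_l2 ?r)\<^sup>2 = (\<integral>x. (cmod (?r x))\<^sup>2 \<partial>sphere_measure)"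
    unfolding sphere_l2_def sq_integral_def
    by (simp add: integral_eq_nn_integral)
  then have "complex_of_real ((sphere_l2 ?r)\<^sup>2) = (\<integral>x. of_real ((cmod (?r x))\<^sup>2) \<partial>sphere_measure)"
    by (simp only: integral_complex_of_real)
  also have "\<dots> = of_real (\<integral>x. (t x)\<^sup>2 \<partial>sphere_measure) - (\<Sum>i\<in>J. cnj (a i) * coef t i)
      - (\<Sum>i\<in>J. a i * cnj (coef t i)) + (\<Sum>i\<in>J. \<Sum>j\<in>J. a i * cnj (a j) * (if i = j then 1 else 0))"
    unfolding sq using tt
    by (simp add: tY tY' YY c c' orth del: of_real_power)
  also have "(\<Sum>i\<in>J. \<Sum>j\<in>J. a i * cnj (a j) * (if i = j then 1 else 0)) = (\<Sum>i\<in>J. a i * cnj (a i))"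
    by (simp add: if_distrib cong: if_cong)
  also have "of_real (\<integral>x. (t x)\<^sup>2 \<partial>sphere_measure) - (\<Sum>i\<in>J. cnj (a i) * coef t i)
      - (\<Sum>i\<in>J. a i * cnj (coef t i)) + (\<Sum>i\<in>J. a i * cnj (a i))
      = of_real ((\<integral>x. (t x)\<^sup>2 \<partial>sphere_measure) - (\<Sum>i\<in>J. (cmod (coef t i))\<^sup>2) + (\<Sum>i\<in>J. (cmod (coef t i - a i))\<^sup>2))"
    unfolding of_real_add of_real_diff of_real_sum complex_norm_square
    by (simp add: algebra_simps sum.distrib sum_subtractf)
  finally show ?thesis
    unfolding J of_real_eq_iff .
qed

text \<open>Bessel's inequality bounds the partial sums from above. For the converse, the defect at
  degree L is at most the squared distance to any harmonic sum of degree L, and some polynomial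
  makes that distance small.\<close>

lemma parseval:
  assumes t [measurable]: "t \<in> borel_measurable sphere_measure" and fin: "sq_integral t < \<infinity>"
  shows "degree_sum (\<lambda>i. (cmod (coef t i))\<^sup>2) sums (\<integral>x. (t x)\<^sup>2 \<partial>sphere_measure)"
proof -
  let ?I = "\<integral>x. (t x)\<^sup>2 \<partial>sphere_measure"
  let ?D = "\<lambda>L. \<Sum>l\<le>L. degree_sum (\<lambda>i. (cmod (coef t i))\<^sup>2) l"
  note residual = sq_integral_residual_partial[OF t fin]
  have upper: "?D L \<le> ?I" for L
  proof -
    have "0 \<le> ?I - ?D L"
      using residual[of "coef t" L]
        zero_le_power2[of "sphere_l2 (\<lambda>x. of_real (t x) - partial_synthesis (coef t) L x)"]
      by (simp add: degree_sum_def)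
    then show ?thesis by simp
  qed
  have mono: "incseq ?D"
    by (intro incseq_SucI) (simp add: degree_sum_nonneg)
  have "?D \<longlonglongrightarrow> ?I"
  proof (rule LIMSEQ_I)
    fix e :: real assume e: "0 < e"
    then obtain p where p: "real_polynomial_function p" "sq_integral (\<lambda>x. t x - p x) < ennreal e"
      using approximable_sq_integrable[OF t fin] by (auto simp: polynomially_approximable_def)
    obtain a L where a: "\<And>x. x \<in> S2 \<Longrightarrow> of_real (p x) = partial_synthesis a L x"
      using harmonic_span_partial_synthesis[OF harmonic_span_real_polynomial[OF p(1)]] by blast
    \<comment> \<open>The dropped sum of |c - a|^2 is nonnegative: no array does better at degree L
      than the coefficients of t.\<close>
    have "?I - ?D L \<le> (sphere_l2 (\<lambda>x. of_real (t x) - partial_synthesis a L x))\<^sup>2"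
      unfolding residual by (simp add: sum_nonneg degree_sum_nonneg)
    also have eq: "sq_integral (\<lambda>x. of_real (t x) - partial_synthesis a L x) = sq_integral (\<lambda>x. t x - p x)"
      unfolding sq_integral_def
      by (intro nn_integral_cong) (simp add: a[symmetric] of_real_diff[symmetric] del: of_real_diff)
    then have "ennreal ((sphere_l2 (\<lambda>x. of_real (t x) - partial_synthesis a L x))\<^sup>2) < ennreal e"
      using p(2) by (subst sphere_l2_power2) (auto intro: less_trans)
    then have "(sphere_l2 (\<lambda>x. of_real (t x) - partial_synthesis a L x))\<^sup>2 < e"
      using e by (simp add: ennreal_less_iff)
    finally have "?I - ?D L < e" .
    then have "norm (?D L' - ?I) < e" if "L \<le> L'" for L'
      using upper[of L'] incseqD[OF mono that] by simp
    then show "\<exists>L. \<forall>L'\<ge>L. norm (?D L' - ?I) < e" by blast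
  qed
  then show ?thesis
    by (simp add: sums_def_le)
qed

text \<open>The finite identity passes to the limit in L. Convergence of the series on the right is
  part of the outcome.\<close>

lemma is_L2_sum_residual:
  assumes t [measurable]: "t \<in> borel_measurable sphere_measure" and fin: "sq_integral t < \<infinity>"
    and f: "is_L2_sum a f"
  shows "sq_integral (\<lambda>x. of_real (t x) - f x) = (\<Sum>l. degree_sum (\<lambda>i. ennreal ((cmod (coef t i - a i))\<^sup>2)) l)"
proof -
  let ?I = "\<integral>x. (t x)\<^sup>2 \<partial>sphere_measure"
  have [measurable]: "f \<in> borel_measurable sphere_measure" and ff: "sq_integral f < \<infinity>"
    using f by (auto simp: is_L2_sum_def L2norm_less_top_iff[unfolded infinity_ennreal_def])
  have tc: "sq_integral (\<lambda>x. complex_of_real (t x)) < \<infinity>"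
    using fin by (simp add: sq_integral_def)
  have "sq_integral (\<lambda>x. f x - partial_synthesis a L x) < \<infinity>" for L
    by (intro sq_integral_diff_finite ff sq_integral_partial_synthesis) measurable
  then have "L2norm (\<lambda>x. f x - partial_synthesis a L x) = ennreal (sphere_l2 (\<lambda>x. f x - partial_synthesis a L x))" for L
    by (simp add: L2norm_eq less_top)
  then have "(\<lambda>L. ennreal (sphere_l2 (\<lambda>x. f x - partial_synthesis a L x))) \<longlonglongrightarrow> ennreal 0"
    using f by (simp add: is_L2_sum_def)
  then have "(\<lambda>L. sphere_l2 (\<lambda>x. f x - partial_synthesis a L x)) \<longlonglongrightarrow> 0"
    by (subst (asm) tendsto_ennreal_iff) auto
  from sphere_l2_tendsto[OF _ _ _ tc ff sq_integral_partial_synthesis this]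
  have "(\<lambda>L. sphere_l2 (\<lambda>x. of_real (t x) - partial_synthesis a L x)) \<longlonglongrightarrow> sphere_l2 (\<lambda>x. of_real (t x) - f x)"
    by simp
  \<comment> \<open>The subtracted Bessel defect of t tends to 0 by \<open>parseval\<close>; what
    remains are exactly the partial sums of |c - a|^2.\<close>
  then have "(\<lambda>L. (sphere_l2 (\<lambda>x. of_real (t x) - partial_synthesis a L x))\<^sup>2
        - (?I - (\<Sum>l\<le>L. degree_sum (\<lambda>i. (cmod (coef t i))\<^sup>2) l)))
      \<longlonglongrightarrow> (sphere_l2 (\<lambda>x. of_real (t x) - f x))\<^sup>2 - (?I - ?I)"
    using parseval[OF t fin] by (intro tendsto_intros) (simp_all add: sums_def_le)
  then have "degree_sum (\<lambda>i. (cmod (coef t i - a i))\<^sup>2) sums (sphere_l2 (\<lambda>x. of_real (t x) - f x))\<^sup>2"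
    unfolding sq_integral_residual_partial[OF t fin] by (simp add: sums_def_le)
  then have "(\<Sum>l. ennreal (degree_sum (\<lambda>i. (cmod (coef t i - a i))\<^sup>2) l)) = ennreal ((sphere_l2 (\<lambda>x. of_real (t x) - f x))\<^sup>2)"
    by (intro suminf_ennreal_eq) (simp_all add: degree_sum_nonneg)
  also have "\<dots> = sq_integral (\<lambda>x. of_real (t x) - f x)"
    by (intro sphere_l2_power2 sq_integral_diff_finite tc ff) measurable
  finally show ?thesis
    by (simp add: degree_sum_ennreal)
qed

text \<open>The right side mentions only the array, so the representative picked by
  \<open>SOME\<close> in \<open>synthesis\<close> is immaterial.\<close>

lemma residual_norm_power2:
  assumes "t \<in> borel_measurable sphere_measure" "sq_integral t < \<infinity>" "\<exists>f. is_L2_sum a f"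
  shows "(residual_norm t a)\<^sup>2 = (\<Sum>l. degree_sum (\<lambda>i. ennreal ((cmod (coef t i - a i))\<^sup>2)) l)"
  using is_L2_sum_residual[OF assms(1,2), of a "synthesis a"] assms(3)
  by (simp add: residual_norm_def L2norm_power2 synthesis_def someI_ex)

text \<open>Every value of \<open>synthesis\<close>, including the dummy 0, is square integrable, so
  a finite residual would force t into L2. Such realizations therefore lie outside the event to be
  measured.\<close>

lemma residual_norm_infinite:
  assumes [measurable]: "t \<in> borel_measurable sphere_measure" and inf: "sq_integral t = \<infinity>"
  shows "residual_norm t a = \<infinity>"
proof -
  have "synthesis a \<in> borel_measurable sphere_measure \<and> L2norm (synthesis a) < \<infinity>"
  proof (cases "\<exists>f. is_L2_sum a f")
    case True
    then have "is_L2_sum a (synthesis a)"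
      by (simp add: synthesis_def someI_ex)
    then show ?thesis
      by (simp add: is_L2_sum_def)
  next
    case False
    then show ?thesis
      by (simp add: synthesis_def L2norm_def)
  qed
  then have [measurable]: "synthesis a \<in> borel_measurable sphere_measure" and s: "sq_integral (synthesis a) < \<infinity>"
    by (auto simp: L2norm_less_top_iff[unfolded infinity_ennreal_def])
  have "\<not> sq_integral (\<lambda>x. of_real (t x) - synthesis a x) < \<infinity>"
  proof
    assume "sq_integral (\<lambda>x. of_real (t x) - synthesis a x) < \<infinity>"
    then have "sq_integral (\<lambda>x. (of_real (t x) - synthesis a x) + synthesis a x) < \<infinity>"
      by (intro sq_integral_add_finite s) measurable
    then show False
      using inf by (simp add: sq_integral_def)
  qed
  then show ?thesis
    by (simp add: residual_norm_def L2norm_eq less_top)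
qed

section \<open>Soft thresholding\<close>

text \<open>The proximal map of lam times the modulus. For lam \<ge> 0 the first branch also catches
  z = 0, where the quotient would be meaningless.\<close>

definition soft :: "real \<Rightarrow> complex \<Rightarrow> complex" where
  "soft lam z = (if cmod z \<le> lam then 0 else of_real (1 - lam / cmod z) * z)"

lemma norm_diff_soft:
  assumes "0 \<le> lam"
  shows "cmod (z - soft lam z) = min (cmod z) lam"
proof (cases "cmod z \<le> lam")
  case False
  then have "z - soft lam z = of_real (lam / cmod z) * z"
    by (simp add: soft_def algebra_simps)
  then show ?thesis
    using False assms by (auto simp: norm_mult norm_divide)
qed (simp add: soft_def)

text \<open>The residual \<open>z - soft lam z\<close> is a subgradient of \<open>lam \<sqdot> cmod\<close> at \<open>soft lam z\<close>.\<close>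

lemma soft_optimal:
  assumes "0 < lam"
  shows "lam * cmod (soft lam z) + (cmod (z - soft lam z))\<^sup>2 / 2 + (cmod (a - soft lam z))\<^sup>2 / 2
    \<le> lam * cmod a + (cmod (z - a))\<^sup>2 / 2"
proof -
  define s where "s = soft lam z"
  define d where "d = z - s"
  have "cmod d \<le> lam"
    using norm_diff_soft[of lam z] assms by (simp add: d_def s_def)
  then have "inner d a \<le> lam * cmod a"
    by (meson norm_cauchy_schwarz mult_right_mono norm_ge_zero order_trans)
  moreover have "inner d s = lam * cmod s"
  proof (cases "cmod z \<le> lam")
    case False
    then have "0 < cmod z"
      using assms by linarith
    moreover from this have "0 < 1 - lam / cmod z"
      using False by simp
    moreover have s: "s = (1 - lam / cmod z) *\<^sub>R z"
      using False by (simp add: s_def soft_def scaleR_conv_of_real)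
    moreover have "d = (lam / cmod z) *\<^sub>R z"
      unfolding d_def s by (simp add: scaleR_diff_left)
    ultimately show ?thesis
      by (simp add: dot_square_norm power2_eq_square)
  qed (simp add: s_def soft_def)
  moreover have "z - a = d - (a - s)"
    by (simp add: d_def)
  \<comment> \<open>The quadratic term in a - s is kept as the gain from strong convexity;
    uniqueness of the minimizer rests on it.\<close>
  then have "(cmod (z - a))\<^sup>2 = (cmod d)\<^sup>2 - 2 * (inner d a - inner d s) + (cmod (a - s))\<^sup>2"
    by (simp only: power2_norm_eq_inner inner_diff inner_commute) (simp add: inner_commute algebra_simps)
  moreover have "w + x / 2 + y / 2 \<le> v + u / 2"
    if "p \<le> v" "q = w" "u = x - 2 * (p - q) + y" for p q u v w x y :: real
    using that by (simp add: field_simps)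
  ultimately show ?thesis
    unfolding s_def[symmetric] d_def[symmetric] by blast
qed

definition soft_coef :: "real \<Rightarrow> (real ^ 3 \<Rightarrow> real) \<Rightarrow> nat \<times> int \<Rightarrow> complex" where
  "soft_coef lam t i = (if i \<in> coef_index then soft lam (coef t i) else 0)"

lemma degree_sum_cong:
  "(\<And>i. i \<in> coef_index \<Longrightarrow> F i = G i) \<Longrightarrow> degree_sum F l = degree_sum G l"
  unfolding degree_sum_def by (intro sum.cong) (auto simp: coef_index_def)

lemma degree_sum_mono:
  fixes F G :: "nat \<times> int \<Rightarrow> 'b::ordered_comm_monoid_add"
  shows "(\<And>i. i \<in> coef_index \<Longrightarrow> F i \<le> G i) \<Longrightarrow> degree_sum F l \<le> degree_sum G l"
  unfolding degree_sum_def by (intro sum_mono) (auto simp: coef_index_def)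

lemma degree_sum_add: "degree_sum (\<lambda>i. F i + G i) l = degree_sum F l + degree_sum G l"
  by (simp add: degree_sum_def sum.distrib)

lemma degree_sum_cmult:
  fixes F :: "nat \<times> int \<Rightarrow> 'b::semiring_0"
  shows "degree_sum (\<lambda>i. c * F i) l = c * degree_sum F l"
  by (simp add: degree_sum_def sum_distrib_left)

text \<open>For \<open>ennreal\<close> values both sides are suprema of finite sums, and every
  finite set of indices lies in some truncation \<open>J n\<close>.\<close>

lemma infsum_coef_index:
  fixes F :: "nat \<times> int \<Rightarrow> ennreal"
  shows "(\<Sum>\<^sub>\<infinity>i\<in>coef_index. F i) = (\<Sum>l. degree_sum F l)"
proof -
  define J where "J n = (SIGMA l:{..<n}. {- int l..int l})" for n
  have J: "(\<Sum>l<n. degree_sum F l) = (\<Sum>i\<in>J n. F i)" for n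
    unfolding J_def degree_sum_def by (subst sum.Sigma) (auto simp: case_prod_beta)
  have "(SUP A\<in>{A. finite A \<and> A \<subseteq> coef_index}. sum F A) = (SUP n. sum F (J n))"
  proof (rule antisym)
    show "(SUP A\<in>{A. finite A \<and> A \<subseteq> coef_index}. sum F A) \<le> (SUP n. sum F (J n))"
    proof (rule SUP_mono)
      fix A assume A: "A \<in> {A. finite A \<and> A \<subseteq> coef_index}"
      then obtain n where n: "\<forall>l\<in>fst ` A. l < n"
        by (metis finite_imageI finite_nat_set_iff_bounded mem_Collect_eq)
      have "A \<subseteq> J n"
      proof
        fix i assume "i \<in> A"
        moreover from this have "fst i < n"
          using n by blast
        ultimately show "i \<in> J n"
          using A by (cases i) (auto simp: J_def coef_index_def)
      qed
      then have "sum F A \<le> sum F (J n)"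
        by (intro sum_mono2) (auto simp: J_def)
      then show "\<exists>n\<in>UNIV. sum F A \<le> sum F (J n)" by blast
    qed
    show "(SUP n. sum F (J n)) \<le> (SUP A\<in>{A. finite A \<and> A \<subseteq> coef_index}. sum F A)"
    proof (rule SUP_mono)
      fix n
      have "finite (J n) \<and> J n \<subseteq> coef_index"
        by (auto simp: J_def coef_index_def)
      then show "\<exists>A\<in>{A. finite A \<and> A \<subseteq> coef_index}. sum F (J n) \<le> sum F A"
        by blast
    qed
  qed
  then show ?thesis
    by (simp add: nonneg_infsum_complete suminf_eq_SUP J)
qed

lemma l1_objective_separable:
  assumes t: "t \<in> borel_measurable sphere_measure" "sq_integral t < \<infinity>" and a: "\<exists>f. is_L2_sum a f"
    and lam: "0 < lam"
  shows "l1_objective lam t a =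
     (\<Sum>l. degree_sum (\<lambda>i. ennreal (lam * cmod (a i) + (cmod (coef t i - a i))\<^sup>2 / 2)) l)"
proof -
  have "l1_objective lam t a = (\<Sum>l. ennreal lam * degree_sum (\<lambda>i. ennreal (cmod (a i))) l)
      + (\<Sum>l. inverse 2 * degree_sum (\<lambda>i. ennreal ((cmod (coef t i - a i))\<^sup>2)) l)"
    by (simp add: l1_objective_def l1norm_def infsum_coef_index residual_norm_power2[OF t a]
        divide_ennreal_def mult.commute)
  also have "\<dots> = (\<Sum>l. degree_sum (\<lambda>i. ennreal lam * ennreal (cmod (a i))
      + inverse 2 * ennreal ((cmod (coef t i - a i))\<^sup>2)) l)"
    by (simp only: suminf_add[OF summableI summableI] degree_sum_add degree_sum_cmult)
  also have "(\<lambda>i. ennreal lam * ennreal (cmod (a i)) + inverse 2 * ennreal ((cmod (coef t i - a i))\<^sup>2))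
      = (\<lambda>i. ennreal (lam * cmod (a i) + (cmod (coef t i - a i))\<^sup>2 / 2))"
  proof
    fix i
    have "inverse 2 = ennreal (1 / 2)"
      using inverse_ennreal[of 2] by (simp add: inverse_eq_divide)
    note inv = this
    show "ennreal lam * ennreal (cmod (a i)) + inverse 2 * ennreal ((cmod (coef t i - a i))\<^sup>2)
        = ennreal (lam * cmod (a i) + (cmod (coef t i - a i))\<^sup>2 / 2)"
    proof -
      have "inverse 2 * ennreal x = ennreal (x / 2)" if "0 \<le> x" for x
      proof -
        have "inverse 2 * ennreal x = ennreal (1 / 2) * ennreal x"
          by (simp only: inv)
        also have "\<dots> = ennreal (1 / 2 * x)"
          using that by (intro ennreal_mult[symmetric]) simp_all
        finally show ?thesis by simp
      qed
      then show ?thesis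
        using lam by (simp add: ennreal_mult ennreal_plus)
    qed
  qed
  finally show ?thesis .
qed

text \<open>The partial sums are stationary from degree L on.\<close>

lemma is_L2_sum_finite_support:
  assumes "\<And>l m. L \<le> l \<Longrightarrow> a (l, m) = 0"
  shows "is_L2_sum a (partial_synthesis a L)"
proof -
  have eq: "partial_synthesis a L' = partial_synthesis a L" if "L \<le> L'" for L'
  proof
    fix x
    show "partial_synthesis a L' x = partial_synthesis a L x"
      unfolding partial_synthesis_def
      using that by (intro sum.mono_neutral_right) (auto simp: assms)
  qed
  have "\<forall>\<^sub>F L' in sequentially. L2norm (\<lambda>x. partial_synthesis a L x - partial_synthesis a L' x) = 0"
    by (intro eventually_sequentiallyI[of L], subst eq) (simp_all add: L2norm_def)
  then have "(\<lambda>L'. L2norm (\<lambda>x. partial_synthesis a L x - partial_synthesis a L' x)) \<longlonglongrightarrow> 0"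
    by (rule tendsto_eventually)
  then show ?thesis
    using sq_integral_partial_synthesis[of a L]
    by (simp add: is_L2_sum_def L2norm_less_top_iff[unfolded infinity_ennreal_def])
qed

lemma degree_sum_suminf_pos:
  fixes F :: "nat \<times> int \<Rightarrow> ennreal"
  assumes "i \<in> coef_index" "0 < F i"
  shows "0 < (\<Sum>l. degree_sum F l)"
proof -
  obtain l m where i: "i = (l, m)"
    by (cases i)
  have "F i \<le> degree_sum F l"
    unfolding degree_sum_def i
    using assms by (intro member_le_sum[where f = "\<lambda>m. F (l, m)"]) (auto simp: coef_index_def i)
  also have "\<dots> \<le> (\<Sum>l. degree_sum F l)"
    using sum_le_suminf[OF summableI, of "{l}" "degree_sum F"] by simp
  finally show ?thesis
    using assms by simp
qed

section \<open>The minimizer for a single square-integrable realization\<close>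

context
  fixes t :: "real ^ 3 \<Rightarrow> real" and lam :: real
  assumes t: "t \<in> borel_measurable sphere_measure" "sq_integral t < \<infinity>" and lam: "0 < lam"
begin

text \<open>Square summability leaves only finitely many coefficients above the threshold.\<close>

lemma is_L2_sum_soft_coef: "\<exists>f. is_L2_sum (soft_coef lam t) f"
proof -
  have "degree_sum (\<lambda>i. (cmod (coef t i))\<^sup>2) \<longlonglongrightarrow> 0"
    using parseval[OF t] by (intro summable_LIMSEQ_zero) (auto simp: summable_def)
  from order_tendstoD(2)[OF this, of "lam\<^sup>2"] lam
  obtain L where L: "\<And>l. L \<le> l \<Longrightarrow> degree_sum (\<lambda>i. (cmod (coef t i))\<^sup>2) l < lam\<^sup>2"
    by (auto simp: eventually_sequentially)
  have "soft_coef lam t (l, m) = 0" if "L \<le> l" for l m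
  proof (cases "(l, m) \<in> coef_index")
    case True
    then have "(cmod (coef t (l, m)))\<^sup>2 \<le> degree_sum (\<lambda>i. (cmod (coef t i))\<^sup>2) l"
      unfolding degree_sum_def
      by (intro member_le_sum[where f = "\<lambda>m. (cmod (coef t (l, m)))\<^sup>2"]) (auto simp: coef_index_def)
    also have "\<dots> < lam\<^sup>2"
      by (rule L[OF that])
    finally have "cmod (coef t (l, m)) \<le> lam"
      using lam by (simp add: power2_less_imp_less less_imp_le)
    then show ?thesis
      by (simp add: soft_coef_def soft_def)
  qed (simp add: soft_coef_def)
  then show ?thesis
    by (blast intro: is_L2_sum_finite_support)
qed

text \<open>The scalar inequality \<open>soft_optimal\<close> is summed over all indices. The gap is
  stated as a sum because subtraction in \<open>ennreal\<close> is truncated.\<close>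

lemma l1_objective_soft_coef:
  assumes a: "\<exists>f. is_L2_sum a f"
  shows "l1_objective lam t (soft_coef lam t)
     + (\<Sum>l. degree_sum (\<lambda>i. ennreal ((cmod (a i - soft_coef lam t i))\<^sup>2 / 2)) l) \<le> l1_objective lam t a"
  unfolding l1_objective_separable[OF t a lam] l1_objective_separable[OF t is_L2_sum_soft_coef lam]
    suminf_add[OF summableI summableI] degree_sum_add[symmetric]
proof (intro suminf_le summableI degree_sum_mono)
  fix i :: "nat \<times> int" assume "i \<in> coef_index"
  then show "ennreal (lam * cmod (soft_coef lam t i) + (cmod (coef t i - soft_coef lam t i))\<^sup>2 / 2)
      + ennreal ((cmod (a i - soft_coef lam t i))\<^sup>2 / 2) \<le> ennreal (lam * cmod (a i) + (cmod (coef t i - a i))\<^sup>2 / 2)"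
    using soft_optimal[OF lam, of "coef t i" "a i"] lam
    by (simp add: soft_coef_def ennreal_plus[symmetric] ennreal_leI del: ennreal_plus)
qed

text \<open>The zero array is the reference competitor: it makes the minimum finite and beats the
  arrays that have no L2 sum.\<close>

lemma l1_objective_zero: "\<exists>f. is_L2_sum (\<lambda>_. 0) f" "l1_objective lam t (\<lambda>_. 0) = sq_integral t / 2"
proof -
  show 0: "\<exists>f. is_L2_sum (\<lambda>_. 0) f"
    using is_L2_sum_finite_support[of 0 "\<lambda>_. 0"] by blast
  have "(residual_norm t (\<lambda>_. 0))\<^sup>2 = (\<Sum>l. degree_sum (\<lambda>i. ennreal ((cmod (coef t i))\<^sup>2)) l)"
    using residual_norm_power2[OF t 0] by simp
  also have "\<dots> = (\<Sum>l. ennreal (degree_sum (\<lambda>i. (cmod (coef t i))\<^sup>2) l))"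
    by (simp add: degree_sum_ennreal)
  also have "\<dots> = ennreal (\<integral>x. (t x)\<^sup>2 \<partial>sphere_measure)"
    using parseval[OF t] by (intro suminf_ennreal_eq) (simp_all add: degree_sum_nonneg)
  also have "\<dots> = sq_integral t"
  proof -
    have "integrable sphere_measure (\<lambda>x. (t x)\<^sup>2)"
      using t by (intro integrableI_bounded) (simp_all add: sq_integral_def)
    then show ?thesis
      by (simp add: sq_integral_def nn_integral_eq_integral)
  qed
  finally show "l1_objective lam t (\<lambda>_. 0) = sq_integral t / 2"
    by (simp add: l1_objective_def l1norm_def)
qed

lemma l1_objective_soft_coef_finite: "l1_objective lam t (soft_coef lam t) < \<infinity>"
proof -
  have "l1_objective lam t (soft_coef lam t) \<le> l1_objective lam t (\<lambda>_. 0)"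
    by (rule order_trans[OF _ l1_objective_soft_coef[OF l1_objective_zero(1)]]) simp
  also have "\<dots> < \<infinity>"
    using t(2) by (simp add: l1_objective_zero(2) ennreal_divide_eq_top_iff less_top[symmetric])
  finally show ?thesis .
qed

text \<open>When \<open>synthesis\<close> takes its dummy value 0, the array is beaten by the zero array.\<close>

lemma soft_coef_strict_minimum:
  assumes a: "a \<in> coef_arrays" "a \<noteq> soft_coef lam t"
  shows "l1_objective lam t (soft_coef lam t) < l1_objective lam t a"
proof (cases "\<exists>f. is_L2_sum a f")
  case True
  obtain i where i: "a i \<noteq> soft_coef lam t i"
    using a(2) by blast
  have "i \<in> coef_index"
  proof (rule ccontr)
    assume "i \<notin> coef_index"
    then have "a i = 0" "soft_coef lam t i = 0"
      using a(1) unfolding coef_arrays_def soft_coef_def by (blast, simp)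
    then show False
      using i by simp
  qed
  then have "0 < (\<Sum>l. degree_sum (\<lambda>i. ennreal ((cmod (a i - soft_coef lam t i))\<^sup>2 / 2)) l)"
    using i by (intro degree_sum_suminf_pos[of i]) auto
  \<comment> \<open>Adding a positive gap gives a strict increase only because the minimum is
    finite.\<close>
  then have "l1_objective lam t (soft_coef lam t) < l1_objective lam t (soft_coef lam t)
     + (\<Sum>l. degree_sum (\<lambda>i. ennreal ((cmod (a i - soft_coef lam t i))\<^sup>2 / 2)) l)"
    using l1_objective_soft_coef_finite by (simp add: ennreal_add_left_cancel_less[of _ 0, simplified])
  also have "\<dots> \<le> l1_objective lam t a"
    by (rule l1_objective_soft_coef[OF True])
  finally show ?thesis .
next
  case False
  \<comment> \<open>The residual term equals that of the zero array, while a is nonzero and pays a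
    strictly positive penalty.\<close>
  then have "a \<noteq> (\<lambda>_. 0)"
    using l1_objective_zero(1) by auto
  then obtain i where i: "a i \<noteq> 0"
    by blast
  have "i \<in> coef_index"
    using a(1) i unfolding coef_arrays_def by blast
  then have pos: "0 < ennreal lam * l1norm a"
    unfolding l1norm_def infsum_coef_index using i lam
    by (auto simp: ennreal_zero_less_mult_iff intro!: degree_sum_suminf_pos[of i])
  have "l1_objective lam t (soft_coef lam t) \<le> l1_objective lam t (\<lambda>_. 0)"
    by (rule order_trans[OF _ l1_objective_soft_coef[OF l1_objective_zero(1)]]) simp
  also have "\<dots> = sq_integral t / 2"
    by (rule l1_objective_zero(2))
  also have "\<dots> < ennreal lam * l1norm a + sq_integral t / 2"
  proof -
    have "sq_integral t / 2 < \<infinity>"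
      using t(2) by (simp add: ennreal_divide_eq_top_iff less_top[symmetric])
    then show ?thesis
      using pos by (simp add: ennreal_add_left_cancel_less[of _ 0, simplified] add.commute)
  qed
  also have "\<dots> = l1_objective lam t a"
    using False by (simp add: l1_objective_def residual_norm_def synthesis_def L2norm_power2 sq_integral_def)
  finally show ?thesis .
qed

lemma minimizes_l1_objective_iff: "minimizes_l1_objective lam t a \<longleftrightarrow> a = soft_coef lam t"
proof -
  have mem: "soft_coef lam t \<in> coef_arrays"
    by (simp add: coef_arrays_def soft_coef_def)
  show ?thesis
    unfolding minimizes_l1_objective_def is_arg_min_def
    using mem soft_coef_strict_minimum by (metis less_asym less_irrefl)
qed

lemma l1_solution_eq: "l1_solution lam t = soft_coef lam t"
proof -
  have "is_arg_min (l1_objective lam t) (\<lambda>a. a \<in> coef_arrays) = (\<lambda>a. a = soft_coef lam t)"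
    using minimizes_l1_objective_iff by (intro ext) (simp add: minimizes_l1_objective_def)
  then show ?thesis
    by (simp add: l1_solution_def arg_min_def)
qed

lemma residual_norm_l1_solution:
  "(residual_norm t (l1_solution lam t))\<^sup>2
     = (\<Sum>l. degree_sum (\<lambda>i. ennreal ((min (cmod (coef t i)) lam)\<^sup>2)) l)"
proof -
  have "degree_sum (\<lambda>i. ennreal ((cmod (coef t i - soft_coef lam t i))\<^sup>2))
      = degree_sum (\<lambda>i. ennreal ((min (cmod (coef t i)) lam)\<^sup>2))"
    using lam by (intro ext degree_sum_cong) (simp add: soft_coef_def norm_diff_soft)
  then show ?thesis
    unfolding l1_solution_eq residual_norm_power2[OF t is_L2_sum_soft_coef] by simp
qed

end

section \<open>Random fields\<close>

lemma nn_integral_normal_law_square: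
  assumes "0 \<le> \<sigma>"
  shows "(\<integral>\<^sup>+y. ennreal (y\<^sup>2) \<partial>normal_law \<mu> \<sigma>) < \<infinity>"
proof (cases "\<sigma> = 0")
  case True
  then show ?thesis
    by (simp add: normal_law_def nn_integral_return)
next
  case False
  then have s: "0 < \<sigma>"
    using assms by simp
  have "integrable lborel (\<lambda>x. normal_density \<mu> \<sigma> x * (x - \<mu>)\<^sup>2)"
    using integrable_normal_moment[OF s, of \<mu> 2] by simp
  moreover have "integrable lborel (\<lambda>x. normal_density \<mu> \<sigma> x * x)"
    using integrable_normal_moment_nz_1[OF s] .
  moreover have "integrable lborel (normal_density \<mu> \<sigma>)"
    using s by (rule integrable_normal_density)
  \<comment> \<open>From x^2 = (x - \<mu>)^2 + 2 \<mu> x - \<mu>^2, which reduces the second moment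
    to the three integrals above.\<close>
  ultimately have "integrable lborel (\<lambda>x. normal_density \<mu> \<sigma> x * (x - \<mu>)\<^sup>2
      + 2 * \<mu> * (normal_density \<mu> \<sigma> x * x) - \<mu>\<^sup>2 * normal_density \<mu> \<sigma> x)"
    by (intro Bochner_Integration.integrable_add Bochner_Integration.integrable_diff integrable_mult_right) auto
  moreover have "(\<lambda>x. normal_density \<mu> \<sigma> x * (x - \<mu>)\<^sup>2
      + 2 * \<mu> * (normal_density \<mu> \<sigma> x * x) - \<mu>\<^sup>2 * normal_density \<mu> \<sigma> x)
      = (\<lambda>x. normal_density \<mu> \<sigma> x * x\<^sup>2)"
    by (simp add: fun_eq_iff power2_eq_square algebra_simps)
  ultimately have "(\<integral>\<^sup>+x. ennreal (normal_density \<mu> \<sigma> x * x\<^sup>2) \<partial>lborel) < \<infinity>"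
    by (auto simp: integrable_iff_bounded)
  moreover have "(\<integral>\<^sup>+y. ennreal (y\<^sup>2) \<partial>normal_law \<mu> \<sigma>) = (\<integral>\<^sup>+x. ennreal (normal_density \<mu> \<sigma> x * x\<^sup>2) \<partial>lborel)"
    using False by (simp add: normal_law_def nn_integral_density ennreal_mult)
  ultimately show ?thesis
    by simp
qed

locale isotropic_gaussian_field = prob_space M for M :: "'w measure" +
  fixes T :: "'w \<Rightarrow> real ^ 3 \<Rightarrow> real"
  assumes field: "spherical_random_field M T"
    and gaussian: "gaussian_field M T"
    and isotropic: "isotropic_field M T"
begin

lemma measurable_field [measurable]: "(\<lambda>(w, x). T w x) \<in> borel_measurable (M \<Otimes>\<^sub>M sphere_measure)"
  using field unfolding spherical_random_field_def
  by (simp cong: measurable_cong_sets add: sets_pair_measure_cong[OF refl sets_sphere_measure])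

lemma measurable_field_section: "x \<in> S2 \<Longrightarrow> (\<lambda>w. T w x) \<in> borel_measurable M"
  using measurable_compose[OF _ measurable_field, of "\<lambda>w. (w, x)" M] by simp

lemma measurable_realization: "w \<in> space M \<Longrightarrow> T w \<in> borel_measurable sphere_measure"
  using measurable_compose[OF _ measurable_field, of "\<lambda>x. (w, x)" sphere_measure] by simp

text \<open>Rotations act transitively on the sphere: for a rotation g taking x to y, the marginal
  at x of the rotated field is the marginal of T at y, and isotropy identifies the two field
  laws.\<close>

lemma distr_field_rotation:
  assumes x: "x \<in> S2" and y: "y \<in> S2"
  shows "distr M borel (\<lambda>w. T w x) = distr M borel (\<lambda>w. T w y)"
proof -
  obtain f :: "real ^ 3 \<Rightarrow> real ^ 3" where f: "orthogonal_transformation f" "det (matrix f) = 1" "f x = y"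
    using rotation_exists[of x y] x y by (auto simp: S2_def)
  define g where "g = matrix f"
  have g: "rotation_matrix g"
    using f orthogonal_transformation_matrix by (auto simp: rotation_matrix_def g_def)
  have fg: "g *v z = f z" for z
    unfolding g_def by (simp add: f(1) matrix_works orthogonal_transformation_linear)
  have rot: "g *v z \<in> S2" if "z \<in> S2" for z
    using that f(1) by (simp add: fg S2_def orthogonal_transformation_norm)
  have marginal: "distr M borel (\<lambda>w. X w x) = distr (field_law M X) borel (\<lambda>h. h x)"
    if "\<And>z. z \<in> S2 \<Longrightarrow> (\<lambda>w. X w z) \<in> borel_measurable M" for X
  proof -
    have "(\<lambda>w. restrict (X w) S2) \<in> measurable M (PiM S2 (\<lambda>_. borel))"
      by (intro measurable_restrict that)
    then show ?thesis
      unfolding field_law_def using x by (subst distr_distr) (auto simp: comp_def)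
  qed
  have "distr M borel (\<lambda>w. T w (g *v x)) = distr M borel (\<lambda>w. T w x)"
    using marginal[of "\<lambda>w x. T w (g *v x)"] marginal[of T] isotropic g rot
    by (simp add: isotropic_field_def measurable_field_section)
  then show ?thesis
    by (simp add: fg f(3))
qed

lemma second_moment:
  obtains B where "B < \<infinity>" "\<And>x. x \<in> S2 \<Longrightarrow> (\<integral>\<^sup>+w. ennreal ((T w x)\<^sup>2) \<partial>M) = B"
proof -
  have mom: "(\<integral>\<^sup>+w. ennreal ((T w x)\<^sup>2) \<partial>M) = (\<integral>\<^sup>+y. ennreal (y\<^sup>2) \<partial>distr M borel (\<lambda>w. T w x))" if "x \<in> S2" for x
    using measurable_field_section[OF that] by (subst nn_integral_distr) auto
  \<comment> \<open>The north pole, serving as an arbitrary reference point; its one-point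
    combination with coefficient 1 is Gaussian.\<close>
  define e where "e = sphere_point (0, 0)"
  have e: "e \<in> S2"
    by (simp add: e_def sphere_point_in_S2)
  have "gaussian_rv M (\<lambda>w. T w e)"
    using gaussian[unfolded gaussian_field_def, rule_format, of "{e}" "\<lambda>_. 1"] e by simp
  then obtain \<mu> \<sigma> where "0 \<le> \<sigma>" "distr M borel (\<lambda>w. T w e) = normal_law \<mu> \<sigma>"
    by (auto simp: gaussian_rv_def)
  then have "(\<integral>\<^sup>+w. ennreal ((T w e)\<^sup>2) \<partial>M) < \<infinity>"
    using nn_integral_normal_law_square by (simp add: mom[OF e])
  then show ?thesis
    using that mom distr_field_rotation[OF _ e] e by metis
qed

lemma measurable_sq_integral: "(\<lambda>w. sq_integral (T w)) \<in> borel_measurable M"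
  unfolding sq_integral_def by measurable

lemma AE_sq_integral_finite: "AE w in M. sq_integral (T w) < \<infinity>"
proof -
  obtain B where B: "B < \<infinity>" "\<And>x. x \<in> S2 \<Longrightarrow> (\<integral>\<^sup>+w. ennreal ((T w x)\<^sup>2) \<partial>M) = B"
    by (rule second_moment) blast
  interpret pair_sigma_finite M sphere_measure ..
  have "(\<integral>\<^sup>+w. sq_integral (T w) \<partial>M) = (\<integral>\<^sup>+w. (\<integral>\<^sup>+x. ennreal ((T w x)\<^sup>2) \<partial>sphere_measure) \<partial>M)"
    by (simp add: sq_integral_def)
  also have "\<dots> = (\<integral>\<^sup>+x. (\<integral>\<^sup>+w. ennreal ((T w x)\<^sup>2) \<partial>M) \<partial>sphere_measure)"
    by (rule Fubini'[symmetric]) measurable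
  also have "\<dots> = (\<integral>\<^sup>+x. B \<partial>sphere_measure)"
    by (intro nn_integral_cong) (simp add: B(2))
  also have "\<dots> < \<infinity>"
    using B(1) by (simp add: ennreal_mult_less_top sphere.emeasure_eq_measure)
  finally show ?thesis
    using nn_integral_PInf_AE[OF measurable_sq_integral] by (auto simp: less_top)
qed

section \<open>Measurability and convergence of the thresholding error\<close>

lemma measurable_harmonic_coef: "(\<lambda>w. harmonic_coef (T w) l m) \<in> borel_measurable M"
proof -
  have [measurable]: "(\<lambda>x. cnj (sph_harm l m x)) \<in> borel_measurable sphere_measure"
    by (intro borel_measurable_sphere_cont continuous_intros continuous_on_sph_harm)
  show ?thesis
    unfolding harmonic_coef_def by measurable
qed

text \<open>The squared residual of the solution on square-integrable realizations, written through
  the harmonic coefficients so that its measurability in w is evident.\<close>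

definition threshold_error :: "real \<Rightarrow> 'w \<Rightarrow> ennreal" where
  "threshold_error lam w = (\<Sum>l. degree_sum (\<lambda>i. ennreal ((min (cmod (coef (T w) i)) lam)\<^sup>2)) l)"

lemma measurable_threshold_error [measurable]: "threshold_error lam \<in> borel_measurable M"
proof -
  note [measurable] = measurable_harmonic_coef
  show ?thesis
    unfolding threshold_error_def degree_sum_def by measurable
qed

text \<open>This describes the event by measurable functions. Finiteness is a separate conjunct
  because outside L2 the coefficients may be default values of non-existing integrals and then carry
  no information about the residual.\<close>

lemma residual_le_iff:
  assumes "0 < lam" "w \<in> space M" "0 < \<epsilon>"
  shows "residual_norm (T w) (l1_solution lam (T w)) \<le> ennreal \<epsilon>
     \<longleftrightarrow> sq_integral (T w) < \<infinity> \<and> threshold_error lam w \<le> ennreal (\<epsilon>\<^sup>2)"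
proof (cases "sq_integral (T w) < \<infinity>")
  case True
  define r where "r = residual_norm (T w) (l1_solution lam (T w))"
  have "r \<le> ennreal \<epsilon> \<longleftrightarrow> r\<^sup>2 \<le> ennreal (\<epsilon>\<^sup>2)"
    using assms(3) by (cases r) (auto simp: ennreal_power top_unique abs_le_square_iff[symmetric])
  moreover have "r\<^sup>2 = threshold_error lam w"
    unfolding r_def threshold_error_def
    by (rule residual_norm_l1_solution[OF measurable_realization[OF assms(2)] True assms(1)])
  ultimately show ?thesis
    using True by (simp add: r_def)
next
  case False
  then have "residual_norm (T w) (l1_solution lam (T w)) = \<infinity>"
    by (intro residual_norm_infinite measurable_realization assms(2)) (simp add: less_top[symmetric])
  then show ?thesis
    using False by (simp add: top_unique)
qed

lemma threshold_error_tendsto: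
  assumes w: "w \<in> space M" "sq_integral (T w) < \<infinity>"
  shows "(\<lambda>n. threshold_error (1 / real (Suc n)) w) \<longlonglongrightarrow> 0"
proof -
  let ?c = "coef (T w)"
  let ?u = "\<lambda>n l. degree_sum (\<lambda>i. ennreal ((min (cmod (?c i)) (1 / real (Suc n)))\<^sup>2)) l"
  have "(\<lambda>n. \<integral>\<^sup>+l. ?u n l \<partial>count_space UNIV) \<longlonglongrightarrow> (\<integral>\<^sup>+l. 0 \<partial>count_space (UNIV :: nat set))"
  proof (rule nn_integral_dominated_convergence)
    \<comment> \<open>The terms of the Parseval series of T w, summable and independent of n,
      dominate because the minimum is at most the modulus.\<close>
    let ?D = "\<lambda>l. ennreal (degree_sum (\<lambda>i. (cmod (?c i))\<^sup>2) l)"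
    have "(\<integral>\<^sup>+l. ?D l \<partial>count_space UNIV) = (\<Sum>l. ?D l)"
      by (rule nn_integral_count_space_nat)
    also have "\<dots> = ennreal (\<integral>x. (T w x)\<^sup>2 \<partial>sphere_measure)"
      by (intro suminf_ennreal_eq degree_sum_nonneg parseval measurable_realization w) simp
    finally show "(\<integral>\<^sup>+l. ?D l \<partial>count_space UNIV) < \<infinity>"
      by simp
    show "AE l in count_space UNIV. ?u n l \<le> ?D l" for n
      by (subst degree_sum_ennreal) (auto intro!: AE_I2 degree_sum_mono ennreal_leI power_mono)
    show "AE l in count_space UNIV. (\<lambda>n. ?u n l) \<longlonglongrightarrow> 0"
    proof (rule AE_I2)
      fix l
      have "(\<lambda>n. ?u n l) \<longlonglongrightarrow> (\<Sum>m = - int l..int l. ennreal ((min (cmod (?c (l, m))) 0)\<^sup>2))"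
        unfolding degree_sum_def
        by (intro tendsto_sum tendsto_ennrealI tendsto_intros LIMSEQ_Suc[OF lim_1_over_n])
      then show "(\<lambda>n. ?u n l) \<longlonglongrightarrow> 0"
        by (simp add: min_absorb2)
    qed
  qed simp_all
  then show ?thesis
    by (simp add: threshold_error_def nn_integral_count_space_nat)
qed

lemma exists_threshold:
  assumes "0 < \<delta>" "0 < \<epsilon>"
  shows "\<exists>lam>0. prob {w \<in> space M. sq_integral (T w) < \<infinity> \<and> threshold_error lam w \<le> ennreal (\<epsilon>\<^sup>2)} \<ge> 1 - \<delta>"
proof -
  note [measurable] = measurable_sq_integral
  define E where "E n = {w \<in> space M. sq_integral (T w) < \<infinity> \<and> threshold_error (1 / real (Suc n)) w \<le> ennreal (\<epsilon>\<^sup>2)}" for n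
  have meas: "E n \<in> sets M" for n
    unfolding E_def by measurable
  \<comment> \<open>A smaller threshold only decreases each term of the error, so the events grow
    and one deterministic n can serve all but a small set of realizations.\<close>
  have "incseq E"
  proof (rule incseq_SucI)
    fix n
    have "threshold_error (1 / real (Suc (Suc n))) w \<le> threshold_error (1 / real (Suc n)) w" for w
      unfolding threshold_error_def
      by (intro suminf_le summableI degree_sum_mono ennreal_leI power_mono min.mono) (auto simp: field_simps)
    then show "E n \<subseteq> E (Suc n)"
      unfolding E_def by (auto intro: order_trans)
  qed
  have "(\<lambda>n. prob (E n)) \<longlonglongrightarrow> prob (\<Union>n. E n)"
    using meas \<open>incseq E\<close> by (intro finite_Lim_measure_incseq) auto
  also have "prob (\<Union>n. E n) = 1"
  proof -
    have "AE w in M. w \<in> (\<Union>n. E n)"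
      using AE_sq_integral_finite
    proof (rule AE_mp, intro AE_I2 impI)
      fix w assume w: "w \<in> space M" "sq_integral (T w) < \<infinity>"
      from order_tendstoD(2)[OF threshold_error_tendsto[OF this], of "ennreal (\<epsilon>\<^sup>2)"] assms(2)
      obtain n where "threshold_error (1 / real (Suc n)) w < ennreal (\<epsilon>\<^sup>2)"
        by (auto simp: eventually_sequentially)
      then show "w \<in> (\<Union>n. E n)"
        using w by (auto simp: E_def intro!: less_imp_le)
    qed
    then show ?thesis
      using meas by (simp add: prob_eq_1)
  qed
  finally have "\<forall>\<^sub>F n in sequentially. 1 - \<delta> < prob (E n)"
    using assms(1) by (intro order_tendstoD(1)) auto
  then obtain n where "1 - \<delta> < prob (E n)"
    by (auto simp: eventually_sequentially)
  then show ?thesis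
    unfolding E_def by (intro exI[of _ "1 / real (Suc n)"]) auto
qed

end

text \<open>Almost sure existence and uniqueness of the minimizer is part of the conclusion, so that
  \<open>l1_solution\<close> denotes a true arg min; measurability of the event is included so that
  its \<open>measure\<close> is a genuine probability.\<close>

theorem proposition2:
  fixes M :: "'w measure"
    and T :: "'w \<Rightarrow> real ^ 3 \<Rightarrow> real"
    and C :: "nat \<Rightarrow> real"
    and K \<alpha> \<delta> \<epsilon> :: real
  assumes "prob_space M"
    and "spherical_random_field M T"
    and "gaussian_field M T"
    and "zero_mean_field M T"
    and "isotropic_field M T"
    and "angular_power_spectrum M T C"
    and "\<And>l. 0 < C l"
    and "0 < K" and "2 < \<alpha>"
    and "\<And>l. 1 \<le> l \<Longrightarrow> C l \<le> K * real l powr (- \<alpha>)"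
    and "0 < \<delta>" and "0 < \<epsilon>"
  shows "\<exists>lam > 0.
           (AE w in M. \<exists>!a. minimizes_l1_objective lam (T w) a) \<and>
           {w \<in> space M. residual_norm (T w) (l1_solution lam (T w)) \<le> ennreal \<epsilon>} \<in> sets M \<and>
           measure M {w \<in> space M. residual_norm (T w) (l1_solution lam (T w)) \<le> ennreal \<epsilon>}
             \<ge> 1 - \<delta>"
proof -
  interpret prob_space M by fact
  interpret isotropic_gaussian_field M T
    by unfold_locales fact+
  note [measurable] = measurable_sq_integral
  obtain lam where lam: "0 < lam"
    and prob: "1 - \<delta> \<le> prob {w \<in> space M. sq_integral (T w) < \<infinity> \<and> threshold_error lam w \<le> ennreal (\<epsilon>\<^sup>2)}"
    using exists_threshold[OF \<open>0 < \<delta>\<close> \<open>0 < \<epsilon>\<close>] by blast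
  have eq: "{w \<in> space M. residual_norm (T w) (l1_solution lam (T w)) \<le> ennreal \<epsilon>}
      = {w \<in> space M. sq_integral (T w) < \<infinity> \<and> threshold_error lam w \<le> ennreal (\<epsilon>\<^sup>2)}"
    using residual_le_iff[OF lam _ \<open>0 < \<epsilon>\<close>] by blast
  \<comment> \<open>Only almost surely: on a realization outside L2 the objective is infinite for
    every array, so each array in \<open>coef_arrays\<close> is a minimizer.\<close>
  have "AE w in M. \<exists>!a. minimizes_l1_objective lam (T w) a"
    using AE_sq_integral_finite
    by (rule AE_mp) (auto simp: minimizes_l1_objective_iff[OF measurable_realization _ lam])
  moreover have "{w \<in> space M. sq_integral (T w) < \<infinity> \<and> threshold_error lam w \<le> ennreal (\<epsilon>\<^sup>2)} \<in> sets M"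
    by measurable
  ultimately show ?thesis
    using lam prob unfolding eq[symmetric] by blast
qed

end
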